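(* Let $\kappa_\varphi,\kappa_u>0$ and consider the circular filtering problem with hidden angle $\varphi_t\in S^1$ and increment observations $$d\varphi_t=\frac{1}{\sqrt{\kappa_\varphi}}\,dW_t,\qquad dU_t=d\varphi_t+\frac{1}{\sqrt{\kappa_u}}\,dV_t ,$$ with $W_t,V_t$ independent standard one-dimensional Brownian motions. The projection filter (defined in the context) for this problem onto the family of von Mises densities $$p_{\mu,\kappa}(\varphi)=\frac{1}{2\pi I_0(\kappa)}\exp(\kappa\cos(\varphi-\mu)),$$ parametrized by mean $\mu$ and precision $\kappa>0$, is given by $$d\mu_t=\frac{\kappa_u}{\kappa_\varphi+\kappa_u}\,dU_t,\qquad d\kappa_t=-\frac{1}{2(\kappa_\varphi+\kappa_u)}\,\mathcal{F}(\kappa_t)\,dt,$$ where $$\mathcal{F}(\kappa)=\frac{F(\kappa)}{1-\frac{F(\kappa)}{\kappa}-F(\kappa)^2},\qquad F(\kappa)=\frac{I_1(\kappa)}{I_0(\kappa)},$$ and the equation for $\mu_t$ is the same in Itô and Stratonovich form.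
   Context: $I_0,I_1$ are the modified Bessel functions of the first kind. Functions on $S^1$ are $2\pi$-periodic functions of $\varphi$, $\mu$ is taken modulo $2\pi$, and $\circ$ denotes Stratonovich integration. Filtering equation. For a smooth test function $\phi$ on $S^1$, the posterior expectation $\mathbb{E}[\phi_t]=\mathbb{E}[\phi(\varphi_t)\mid U_{0:t}]$ evolves according to the generalized Kushner–Stratonovich equation (Itô form) $$d\mathbb{E}[\phi_t]=\frac{1}{2\kappa_\varphi}\mathbb{E}[\partial_\varphi^2\phi_t]\,dt+\frac{\kappa_u}{\kappa_\varphi+\kappa_u}\,\mathbb{E}[\partial_\varphi\phi_t]\,dU_t .$$ Rewriting this in Stratonovich form, for the posterior density $p_t$ on $S^1$, gives $dp_t=\mathcal{A}^\dagger[p_t]\,dt+\mathcal{B}^\dagger[p_t]\circ dU_t$, which defines $\mathcal{A}^\dagger,\mathcal{B}^\dagger$. Projection filter. For a parametric family $\{p_\theta\}$ of densities on $S^1$ with parameters $\theta=(\theta_1,\dots,\theta_m)$, let $g_{ij}=\mathbb{E}_{p_\theta}\big[\frac{\partial\log p_\theta}{\partial\theta_i}\frac{\partial\log p_\theta}{\partial\theta_j}\big]$ be the Fisher metric, $g^{ij}$ the components of its inverse, and $\langle Z_1,Z_2\rangle_\theta=\int_{S^1}Z_1Z_2/p_\theta\,d\varphi$. The projection filter is the Stratonovich SDE for the parameters $$d\theta_j=\sum_ig^{ij}\Big\langle\mathcal{A}^\dagger[p_\theta],\tfrac{\partial p_\theta}{\partial\theta_i}\Big\rangle_\theta dt+\sum_ig^{ij}\Big\langle\mathcal{B}^\dagger[p_\theta],\tfrac{\partial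 p_\theta}{\partial\theta_i}\Big\rangle_\theta\circ dU_t ,$$ i.e. the evolution obtained by orthogonally projecting the Stratonovich vector fields, with respect to $\langle\cdot,\cdot\rangle_\theta$, onto the tangent space of the family. Here $\theta=(\mu,\kappa)$. *)

theory Defs
  imports "HOL-Probability.Probability"
begin

section \<open>Brownian motion and observation filtrations\<close>

text \<open>Processes are indexed by all reals, but only times \<open>t \<ge> 0\<close> are ever referred to.\<close>

definition natural_filtration :: "'a measure \<Rightarrow> (real \<Rightarrow> 'a \<Rightarrow> real) \<Rightarrow> real \<Rightarrow> 'a measure" where
  "natural_filtration M X t =
     sigma (space M) {X s -` B \<inter> space M | s B. 0 \<le> s \<and> s \<le> t \<and> B \<in> sets borel}"

definition process_events :: "'a measure \<Rightarrow> (real \<Rightarrow> 'a \<Rightarrow> real) \<Rightarrow> 'a set set" where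
  "process_events M X =
     sigma_sets (space M) {X s -` B \<inter> space M | s B. 0 \<le> s \<and> B \<in> sets borel}"

text \<open>\<open>X\<close> is adapted to \<open>F\<close>, and its increments after time \<open>s\<close> are independent of \<open>F s\<close>.\<close>

definition independent_increments ::
  "'a measure \<Rightarrow> (real \<Rightarrow> 'a measure) \<Rightarrow> (real \<Rightarrow> 'a \<Rightarrow> real) \<Rightarrow> bool" where
  "independent_increments M F X \<longleftrightarrow>
     (\<forall>t\<ge>0. X t \<in> borel_measurable (F t)) \<and>
     (\<forall>s\<ge>0. \<forall>t>s. prob_space.indep_set M (sets (F s))
        {(\<lambda>\<omega>. X t \<omega> - X s \<omega>) -` B \<inter> space M | B. B \<in> sets borel})"

definition brownian_motion :: "'a measure \<Rightarrow> (real \<Rightarrow> 'a \<Rightarrow> real) \<Rightarrow> bool" where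
  "brownian_motion M W \<longleftrightarrow>
     (\<forall>t\<ge>0. W t \<in> borel_measurable M) \<and>
     (AE \<omega> in M. W 0 \<omega> = 0) \<and>
     (AE \<omega> in M. continuous_on {0..} (\<lambda>t. W t \<omega>)) \<and>
     independent_increments M (natural_filtration M W) W \<and>
     (\<forall>s\<ge>0. \<forall>t>s. distributed M lborel (\<lambda>\<omega>. W t \<omega> - W s \<omega>) (normal_density 0 (sqrt (t - s))))"

definition independent_processes ::
  "'a measure \<Rightarrow> (real \<Rightarrow> 'a \<Rightarrow> real) \<Rightarrow> (real \<Rightarrow> 'a \<Rightarrow> real) \<Rightarrow> bool" where
  "independent_processes M X Y \<longleftrightarrow>
     prob_space.indep_set M (process_events M X) (process_events M Y)"

text \<open>The angle is represented by its continuous real-valued lift \<open>\<phi>\<close>.\<close>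

definition circular_filtering_model ::
  "'a measure \<Rightarrow> real \<Rightarrow> real \<Rightarrow> (real \<Rightarrow> 'a \<Rightarrow> real) \<Rightarrow> (real \<Rightarrow> 'a \<Rightarrow> real) \<Rightarrow>
   (real \<Rightarrow> 'a \<Rightarrow> real) \<Rightarrow> (real \<Rightarrow> 'a \<Rightarrow> real) \<Rightarrow> bool" where
  "circular_filtering_model M k\<^sub>\<phi> k\<^sub>u W V \<phi> U \<longleftrightarrow>
     brownian_motion M W \<and> brownian_motion M V \<and> independent_processes M W V \<and>
     (\<forall>t\<ge>0. \<phi> t \<in> borel_measurable M) \<and> (\<forall>t\<ge>0. U t \<in> borel_measurable M) \<and>
     (AE \<omega> in M. \<forall>t\<ge>0. \<phi> t \<omega> = \<phi> 0 \<omega> + 1 / sqrt k\<^sub>\<phi> * W t \<omega>) \<and>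
     (AE \<omega> in M. \<forall>t\<ge>0. U t \<omega> = U 0 \<omega> + (\<phi> t \<omega> - \<phi> 0 \<omega>) + 1 / sqrt k\<^sub>u * V t \<omega>)"

text \<open>
  A filtration with respect to which \<open>X\<close> may serve as an integrator. For the observations \<open>U\<close>
  started at \<open>0\<close> this includes the observation filtration \<open>natural_filtration M U\<close>.
\<close>

definition admissible_filtration ::
  "'a measure \<Rightarrow> (real \<Rightarrow> 'a measure) \<Rightarrow> (real \<Rightarrow> 'a \<Rightarrow> real) \<Rightarrow> bool" where
  "admissible_filtration M F X \<longleftrightarrow>
     filtration (space M) F \<and> (\<forall>t. subalgebra M (F t)) \<and> independent_increments M F X"


section \<open>Ito and Stratonovich integrals\<close>

definition converges_in_probability ::
  "'a measure \<Rightarrow> (nat \<Rightarrow> 'a \<Rightarrow> real) \<Rightarrow> ('a \<Rightarrow> real) \<Rightarrow> bool" where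
  "converges_in_probability M Y L \<longleftrightarrow>
     (\<forall>k. Y k \<in> borel_measurable M) \<and> L \<in> borel_measurable M \<and>
     (\<forall>\<epsilon>>0. (\<lambda>k. measure M {\<omega> \<in> space M. \<bar>Y k \<omega> - L \<omega>\<bar> > \<epsilon>}) \<longlonglongrightarrow> 0)"

text \<open>The \<open>k\<close>-th partition of \<open>{0..t}\<close> is \<open>0 = s k 0 \<le> \<dots> \<le> s k (N k) = t\<close>; the mesh tends to \<open>0\<close>.\<close>

definition partition_sequence :: "real \<Rightarrow> (nat \<Rightarrow> nat) \<Rightarrow> (nat \<Rightarrow> nat \<Rightarrow> real) \<Rightarrow> bool" where
  "partition_sequence t N s \<longleftrightarrow>
     (\<forall>k. s k 0 = 0 \<and> s k (N k) = t \<and> (\<forall>i<N k. s k i \<le> s k (Suc i))) \<and>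
     (\<forall>\<delta>>0. \<forall>\<^sub>F k in sequentially. \<forall>i<N k. s k (Suc i) - s k i < \<delta>)"

definition ito_integral ::
  "'a measure \<Rightarrow> (real \<Rightarrow> 'a \<Rightarrow> real) \<Rightarrow> (real \<Rightarrow> 'a \<Rightarrow> real) \<Rightarrow> (real \<Rightarrow> 'a \<Rightarrow> real) \<Rightarrow> bool" where
  "ito_integral M H X J \<longleftrightarrow>
     (\<forall>t\<ge>0. \<forall>N s. partition_sequence t N s \<longrightarrow>
        converges_in_probability M
          (\<lambda>k \<omega>. \<Sum>i<N k. H (s k i) \<omega> * (X (s k (Suc i)) \<omega> - X (s k i) \<omega>)) (J t))"

definition stratonovich_integral ::
  "'a measure \<Rightarrow> (real \<Rightarrow> 'a \<Rightarrow> real) \<Rightarrow> (real \<Rightarrow> 'a \<Rightarrow> real) \<Rightarrow> (real \<Rightarrow> 'a \<Rightarrow> real) \<Rightarrow> bool" where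
  "stratonovich_integral M H X J \<longleftrightarrow>
     (\<forall>t\<ge>0. \<forall>N s. partition_sequence t N s \<longrightarrow>
        converges_in_probability M
          (\<lambda>k \<omega>. \<Sum>i<N k. (H (s k i) \<omega> + H (s k (Suc i)) \<omega>) / 2 *
                              (X (s k (Suc i)) \<omega> - X (s k i) \<omega>)) (J t))"

text \<open>The rate \<open>q\<close> in \<open>d[X] = q dt\<close>, for processes whose quadratic variation is of this form.\<close>

definition quadratic_variation_rate :: "'a measure \<Rightarrow> (real \<Rightarrow> 'a \<Rightarrow> real) \<Rightarrow> real" where
  "quadratic_variation_rate M X =
     (THE q. \<forall>t\<ge>0. \<forall>N s. partition_sequence t N s \<longrightarrow>
        converges_in_probability M
          (\<lambda>k \<omega>. \<Sum>i<N k. (X (s k (Suc i)) \<omega> - X (s k i) \<omega>)\<^sup>2) (\<lambda>\<omega>. q * t))"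

text \<open>
  Solutions in the domain \<open>\<Theta>\<close> of \<open>d\<theta> = b \<theta> dt + \<sigma> \<theta> dX\<close>, where the argument \<open>integral_of\<close>
  (\<open>ito_integral\<close> or \<open>stratonovich_integral\<close>) says how \<open>dX\<close> is to be read.
\<close>

definition sde_solution ::
  "('a measure \<Rightarrow> (real \<Rightarrow> 'a \<Rightarrow> real) \<Rightarrow> (real \<Rightarrow> 'a \<Rightarrow> real) \<Rightarrow> (real \<Rightarrow> 'a \<Rightarrow> real) \<Rightarrow> bool) \<Rightarrow>
   'a measure \<Rightarrow> (real \<Rightarrow> 'a measure) \<Rightarrow> (real \<Rightarrow> 'a \<Rightarrow> real) \<Rightarrow> (real ^ 'm) set \<Rightarrow>
   (real ^ 'm \<Rightarrow> real ^ 'm) \<Rightarrow> (real ^ 'm \<Rightarrow> real ^ 'm) \<Rightarrow> (real \<Rightarrow> 'a \<Rightarrow> real ^ 'm) \<Rightarrow> bool" where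
  "sde_solution integral_of M F X \<Theta> b \<sigma> \<theta> \<longleftrightarrow>
     (\<forall>t\<ge>0. \<theta> t \<in> borel_measurable (F t)) \<and>
     (\<forall>t\<ge>0. \<forall>\<omega>\<in>space M. \<theta> t \<omega> \<in> \<Theta>) \<and>
     (AE \<omega> in M. continuous_on {0..} (\<lambda>t. \<theta> t \<omega>)) \<and>
     (\<forall>j. \<exists>J. integral_of M (\<lambda>t \<omega>. \<sigma> (\<theta> t \<omega>) $ j) X J \<and>
        (\<forall>t\<ge>0. AE \<omega> in M.
           ((\<lambda>s. b (\<theta> s \<omega>) $ j) has_integral (\<theta> t \<omega> $ j - \<theta> 0 \<omega> $ j - J t \<omega>)) {0..t}))"


section \<open>The filtering equation for densities\<close>

text \<open>Functions on the circle are \<open>2\<pi>\<close>-periodic functions on the reals.\<close>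

definition circle_smooth :: "(real \<Rightarrow> real) \<Rightarrow> bool" where
  "circle_smooth f \<longleftrightarrow>
     (\<forall>n x. (deriv ^^ n) f field_differentiable at x) \<and> (\<forall>x. f (x + 2 * pi) = f x)"

definition circle_integral :: "(real \<Rightarrow> real) \<Rightarrow> real" where
  "circle_integral f = integral {0..2 * pi} f"

text \<open>The formal adjoint of an operator on test functions, acting on smooth densities.\<close>

definition circle_adjoint ::
  "((real \<Rightarrow> real) \<Rightarrow> (real \<Rightarrow> real)) \<Rightarrow> (real \<Rightarrow> real) \<Rightarrow> (real \<Rightarrow> real)" where
  "circle_adjoint T p =
     (THE r. circle_smooth r \<and>
        (\<forall>f. circle_smooth f \<longrightarrow>
           circle_integral (\<lambda>x. f x * r x) = circle_integral (\<lambda>x. T f x * p x)))"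

text \<open>
  Drift and diffusion of the filtering equation
  \<open>d E[f] = E[ks_drift f] dt + E[ks_diffusion f] dU\<close> (Ito form).
\<close>

definition ks_drift :: "real \<Rightarrow> (real \<Rightarrow> real) \<Rightarrow> (real \<Rightarrow> real)" where
  "ks_drift k\<^sub>\<phi> f = (\<lambda>x. 1 / (2 * k\<^sub>\<phi>) * deriv (deriv f) x)"

definition ks_diffusion :: "real \<Rightarrow> real \<Rightarrow> (real \<Rightarrow> real) \<Rightarrow> (real \<Rightarrow> real)" where
  "ks_diffusion k\<^sub>\<phi> k\<^sub>u f = (\<lambda>x. k\<^sub>u / (k\<^sub>\<phi> + k\<^sub>u) * deriv f x)"

text \<open>
  Conversion of the Ito equation \<open>dp = b[p] dt + \<sigma>[p] dX\<close> with \<open>d[X] = q dt\<close>: the Stratonovich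
  drift is \<open>b[p] - (q/2) D\<sigma>[p](\<sigma>[p])\<close>, where \<open>D\<sigma>[p](v)\<close> is the derivative of \<open>\<sigma>\<close> at \<open>p\<close> in
  direction \<open>v\<close>; the diffusion \<open>\<sigma>\<close> is unchanged.
\<close>

definition stratonovich_drift ::
  "real \<Rightarrow> ((real \<Rightarrow> real) \<Rightarrow> (real \<Rightarrow> real)) \<Rightarrow> ((real \<Rightarrow> real) \<Rightarrow> (real \<Rightarrow> real)) \<Rightarrow>
   (real \<Rightarrow> real) \<Rightarrow> (real \<Rightarrow> real)" where
  "stratonovich_drift q b \<sigma> p =
     (\<lambda>x. b p x - q / 2 * deriv (\<lambda>\<epsilon>. \<sigma> (\<lambda>y. p y + \<epsilon> * \<sigma> p y) x) 0)"

definition B_dagger :: "real \<Rightarrow> real \<Rightarrow> (real \<Rightarrow> real) \<Rightarrow> (real \<Rightarrow> real)" where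
  "B_dagger k\<^sub>\<phi> k\<^sub>u = circle_adjoint (ks_diffusion k\<^sub>\<phi> k\<^sub>u)"

definition A_dagger ::
  "'a measure \<Rightarrow> (real \<Rightarrow> 'a \<Rightarrow> real) \<Rightarrow> real \<Rightarrow> real \<Rightarrow> (real \<Rightarrow> real) \<Rightarrow> (real \<Rightarrow> real)" where
  "A_dagger M U k\<^sub>\<phi> k\<^sub>u =
     stratonovich_drift (quadratic_variation_rate M U)
       (circle_adjoint (ks_drift k\<^sub>\<phi>)) (B_dagger k\<^sub>\<phi> k\<^sub>u)"


section \<open>Projection onto a parametric family\<close>

definition param_deriv :: "'m \<Rightarrow> (real ^ 'm \<Rightarrow> real) \<Rightarrow> real ^ 'm \<Rightarrow> real" where
  "param_deriv i f \<theta> = deriv (\<lambda>s. f (\<chi> j. if j = i then s else \<theta> $ j)) (\<theta> $ i)"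

definition fisher_metric :: "(real ^ 'm \<Rightarrow> real \<Rightarrow> real) \<Rightarrow> real ^ 'm \<Rightarrow> real ^ 'm ^ 'm" where
  "fisher_metric p \<theta> =
     (\<chi> i j. circle_integral (\<lambda>x. param_deriv i (\<lambda>\<eta>. ln (p \<eta> x)) \<theta> *
                                 param_deriv j (\<lambda>\<eta>. ln (p \<eta> x)) \<theta> * p \<theta> x))"

definition density_inner :: "(real \<Rightarrow> real) \<Rightarrow> (real \<Rightarrow> real) \<Rightarrow> (real \<Rightarrow> real) \<Rightarrow> real" where
  "density_inner p Z\<^sub>1 Z\<^sub>2 = circle_integral (\<lambda>x. Z\<^sub>1 x * Z\<^sub>2 x / p x)"

text \<open>Coordinates of the orthogonal projection of the vector field \<open>T\<close> on densities.\<close>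

definition projected_field ::
  "(real ^ 'm \<Rightarrow> real \<Rightarrow> real) \<Rightarrow> ((real \<Rightarrow> real) \<Rightarrow> (real \<Rightarrow> real)) \<Rightarrow> real ^ 'm \<Rightarrow> real ^ 'm" where
  "projected_field p T \<theta> =
     (\<chi> j. \<Sum>i\<in>UNIV. matrix_inv (fisher_metric p \<theta>) $ i $ j *
        density_inner (p \<theta>) (T (p \<theta>)) (\<lambda>x. param_deriv i (\<lambda>\<eta>. p \<eta> x) \<theta>))"

definition projection_filter ::
  "'a measure \<Rightarrow> (real \<Rightarrow> 'a measure) \<Rightarrow> (real \<Rightarrow> 'a \<Rightarrow> real) \<Rightarrow> real \<Rightarrow> real \<Rightarrow>
   (real ^ 'm) set \<Rightarrow> (real ^ 'm \<Rightarrow> real \<Rightarrow> real) \<Rightarrow> (real \<Rightarrow> 'a \<Rightarrow> real ^ 'm) \<Rightarrow> bool" where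
  "projection_filter M F U k\<^sub>\<phi> k\<^sub>u \<Theta> p \<theta> \<longleftrightarrow>
     sde_solution stratonovich_integral M F U \<Theta>
       (projected_field p (A_dagger M U k\<^sub>\<phi> k\<^sub>u)) (projected_field p (B_dagger k\<^sub>\<phi> k\<^sub>u)) \<theta>"


section \<open>The von Mises family\<close>

text \<open>Modified Bessel functions of the first kind, of integer order.\<close>

definition bessel_I :: "nat \<Rightarrow> real \<Rightarrow> real" where
  "bessel_I n x = (\<Sum>k. (x / 2) ^ (2 * k + n) / (fact k * fact (k + n)))"

definition bessel_ratio :: "real \<Rightarrow> real" where
  "bessel_ratio \<kappa> = bessel_I 1 \<kappa> / bessel_I 0 \<kappa>"

definition precision_decay :: "real \<Rightarrow> real" where
  "precision_decay \<kappa> = bessel_ratio \<kappa> / (1 - bessel_ratio \<kappa> / \<kappa> - (bessel_ratio \<kappa>)\<^sup>2)"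

text \<open>The parameter vector is \<open>(\<mu>, \<kappa>)\<close>; \<open>\<mu>\<close> is a real lift of the mean angle.\<close>

definition von_mises :: "real ^ 2 \<Rightarrow> real \<Rightarrow> real" where
  "von_mises \<theta> x = 1 / (2 * pi * bessel_I 0 (\<theta> $ 2)) * exp (\<theta> $ 2 * cos (x - \<theta> $ 1))"

definition von_mises_domain :: "(real ^ 2) set" where
  "von_mises_domain = {\<theta>. \<theta> $ 2 > 0}"

end

theory Submission
  imports Defs
begin

text \<open>
  The circle generator and the first-order diffusion are adjoint to multiples of \<open>p''\<close> and \<open>p'\<close>;
  since \<open>d[U] = (1/k\<^sub>\<phi> + 1/k\<^sub>u) dt\<close>, the Stratonovich correction of the drift is again a multiple of
  \<open>p''\<close>, and the total is \<open>p'' / (2 (k\<^sub>\<phi> + k\<^sub>u))\<close>. On the von Mises family \<open>p'\<close> is minus the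
  \<open>\<mu>\<close>-derivative, hence tangent. Reflection about \<open>\<mu>\<close> makes the Fisher metric diagonal and
  kills the \<open>\<mu>\<close>-component of \<open>p''\<close>, while two integrations by parts turn the \<open>\<kappa>\<close>-component into
  \<open>E[cos''] = - F(\<kappa>)\<close>. The diffusion field is constant in the parameters, so the midpoint and the
  left-endpoint Riemann sums coincide.
\<close>

section \<open>Calculus on the circle\<close>

text \<open>Several objects are specified only implicitly, and this shapes most of the work.
  \<open>circle_adjoint\<close> and \<open>quadratic_variation_rate\<close> are definite
  descriptions, so a formula for them needs uniqueness besides a candidate: a smooth periodic
  function with vanishing square integral is zero, and a sequence has at most one constant limit in
  probability. The rate of \<open>U\<close> has to be derived from the Brownian model: its
  increments are Gaussian with known second and fourth moments, and their independence from the past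
  controls the variance of the sum of squares. \<open>bessel_I\<close> is a power series, whereas
  metric and pairings are integrals; expanding exp(\<kappa> cos x) and integrating powers of cosine
  links the two. The quotient in \<open>precision_decay\<close> is meaningful because its
  denominator is the variance of cos(x - \<mu>), that is, the metric coefficient of \<kappa>, and
  hence strictly positive.\<close>

lemma circle_integral_add:
  assumes "continuous_on UNIV f" "continuous_on UNIV g"
  shows "circle_integral (\<lambda>x. f x + g x) = circle_integral f + circle_integral g"
  unfolding circle_integral_def
  by (intro integral_add integrable_continuous_real continuous_on_subset[OF assms(1)]
      continuous_on_subset[OF assms(2)]) auto

lemma circle_integral_diff:
  assumes "continuous_on UNIV f" "continuous_on UNIV g"
  shows "circle_integral (\<lambda>x. f x - g x) = circle_integral f - circle_integral g"
  unfolding circle_integral_def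
  by (intro integral_diff integrable_continuous_real continuous_on_subset[OF assms(1)]
      continuous_on_subset[OF assms(2)]) auto

lemma circle_integral_cmult: "circle_integral (\<lambda>x. c * f x) = c * circle_integral f"
  unfolding circle_integral_def by simp

lemma circle_integral_derivative_eq_0:
  assumes "\<And>x. (f has_real_derivative f' x) (at x)" and "f (2 * pi) = f 0"
  shows "circle_integral f' = 0"
proof -
  have "(f' has_integral (f (2 * pi) - f 0)) {0..2*pi}"
    by (rule fundamental_theorem_of_calculus)
       (auto intro!: has_field_derivative_at_within assms(1)
             simp flip: has_real_derivative_iff_has_vector_derivative)
  then show ?thesis
    using assms(2) by (simp add: circle_integral_def integral_unique)
qed

text \<open>The substitution x -> 2\<pi> - x, carried out as a reflection followed by a shift, turns
  the integral into its own negative.\<close>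

lemma circle_integral_odd:
  assumes "\<And>x. h (2 * pi - x) = - h x"
  shows "circle_integral h = 0"
proof -
  have "integral {0..2*pi} h = integral {-2*pi..0} (\<lambda>x. h (- x))"
    using Henstock_Kurzweil_Integration.integral_reflect_real[of "2*pi" 0 h] by simp
  also have "\<dots> = integral {0..2*pi} (\<lambda>x. h (- (x - 2 * pi)))"
    using integral_shift_Icc_real[of "-2*pi" "0" "\<lambda>x. h (- (x - 2 * pi))" "2*pi"]
    by (simp add: o_def algebra_simps)
  also have "\<dots> = - integral {0..2*pi} h"
    using assms by (simp add: algebra_simps)
  finally show ?thesis
    by (simp add: circle_integral_def)
qed

text \<open>For an antiderivative \<open>H\<close>, the integral over one period starting at a is
  \<open>H (a + 2 * pi) - H a\<close>; its derivative in a vanishes by periodicity.\<close>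

lemma circle_integral_shift:
  assumes cont: "continuous_on UNIV h" and per: "\<And>x. h (x + 2 * pi) = h x"
  shows "circle_integral (\<lambda>x. h (x - \<mu>)) = circle_integral h"
proof -
  obtain H where H: "\<And>x. (H has_vector_derivative h x) (at x)"
    using einterval_antiderivative[of "-\<infinity>" "\<infinity>" h] cont
    by (auto simp: continuous_on_eq_continuous_at)
  have H': "(H has_real_derivative h x) (at x)" for x
    using H by (simp add: has_real_derivative_iff_has_vector_derivative)
  have shift: "((\<lambda>x. H (x + a)) has_real_derivative h (x + a)) (at x)" for x a
    using DERIV_shift[of H] H' by blast
  define D where "D a = H (a + 2 * pi) - H a" for a
  have "(D has_real_derivative h (a + 2 * pi) - h a) (at a)" for a
    unfolding D_def by (intro DERIV_diff H' shift)
  then have "\<forall>a. (D has_real_derivative 0) (at a)"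
    by (simp add: per)
  then have D: "D (- \<mu>) = D 0"
    by (rule DERIV_isconst_all)
  have "((\<lambda>x. h (x - \<mu>)) has_integral (H (2 * pi - \<mu>) - H (0 - \<mu>))) {0..2*pi}"
    by (rule fundamental_theorem_of_calculus)
       (auto intro!: has_field_derivative_at_within shift[of "- \<mu>", simplified]
             simp flip: has_real_derivative_iff_has_vector_derivative)
  moreover have "(h has_integral (H (2 * pi) - H 0)) {0..2*pi}"
    by (rule fundamental_theorem_of_calculus)
       (auto intro!: has_vector_derivative_at_within H)
  ultimately show ?thesis
    using D by (simp add: circle_integral_def integral_unique D_def)
qed

text \<open>The source of every strict inequality about integrals below: uniqueness of adjoints,
  positivity of I_0, and nondegeneracy of the Fisher metric in the direction of \<kappa>.\<close>

lemma circle_integral_pos: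
  assumes cont: "continuous_on UNIV h" and nonneg: "\<And>x. 0 \<le> h x"
    and x0: "x0 \<in> {0..2*pi}" "h x0 \<noteq> 0"
  shows "0 < circle_integral h"
proof -
  have c: "continuous_on {0..2*pi} h"
    using cont continuous_on_subset by blast
  have "circle_integral h \<noteq> 0"
    unfolding circle_integral_def
    using integral_eq_0_iff[of 0 "2*pi" h] c nonneg x0 by auto
  moreover have "0 \<le> circle_integral h"
    unfolding circle_integral_def
    by (rule integral_nonneg) (use c nonneg in \<open>auto intro: integrable_continuous_real\<close>)
  ultimately show ?thesis
    by linarith
qed

section \<open>Smooth functions on the circle and formal adjoints\<close>

text \<open>Smoothness cut off at n derivatives, so that closure properties can be proved by
  induction on n. Products and exponentials reappear in their own derivatives, which is harmless
  because one order of differentiability has been spent.\<close>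

definition iter_differentiable :: "nat \<Rightarrow> (real \<Rightarrow> real) \<Rightarrow> bool" where
  "iter_differentiable n f \<longleftrightarrow> (\<forall>k<n. \<forall>x. (deriv ^^ k) f field_differentiable at x)"

lemma iter_differentiable_0: "iter_differentiable 0 f"
  by (simp add: iter_differentiable_def)

lemma iter_differentiable_Suc:
  "iter_differentiable (Suc n) f \<longleftrightarrow>
     (\<forall>x. f field_differentiable at x) \<and> iter_differentiable n (deriv f)"
proof -
  have *: "(\<forall>k<Suc n. P k) \<longleftrightarrow> P 0 \<and> (\<forall>k<n. P (Suc k))" for P
    by (auto simp: less_Suc_eq_0_disj)
  show ?thesis
    unfolding iter_differentiable_def * by (simp add: funpow_Suc_right del: funpow.simps(2))
qed

lemma iter_differentiable_SucI:
  assumes "\<And>x. (f has_real_derivative f' x) (at x)" and "iter_differentiable n f'"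
  shows "iter_differentiable (Suc n) f"
proof -
  have "deriv f = f'"
    using assms(1) by (auto intro: DERIV_imp_deriv)
  then show ?thesis
    using assms by (auto simp: iter_differentiable_Suc field_differentiable_def)
qed

lemma iter_differentiable_SucE:
  assumes "iter_differentiable (Suc n) f"
  shows "(f has_real_derivative deriv f x) (at x)" and "iter_differentiable n (deriv f)"
  using assms by (auto simp: iter_differentiable_Suc field_differentiable_derivI)

lemma iter_differentiable_Suc_imp: "iter_differentiable (Suc n) f \<Longrightarrow> iter_differentiable n f"
  by (simp add: iter_differentiable_def)

lemma iter_differentiable_const: "iter_differentiable n (\<lambda>x. c)"
proof (induction n arbitrary: c)
  case (Suc n)
  show ?case by (rule iter_differentiable_SucI[OF _ Suc[of 0]]) auto
qed (simp add: iter_differentiable_0)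

lemma iter_differentiable_add:
  assumes "iter_differentiable n f" "iter_differentiable n g"
  shows "iter_differentiable n (\<lambda>x. f x + g x)"
  using assms
proof (induction n arbitrary: f g)
  case (Suc n)
  note f = iter_differentiable_SucE[OF Suc.prems(1)] and g = iter_differentiable_SucE[OF Suc.prems(2)]
  show ?case
    by (rule iter_differentiable_SucI[OF _ Suc.IH[OF f(2) g(2)]]) (intro DERIV_add f g)
qed (simp add: iter_differentiable_0)

lemma iter_differentiable_mult:
  assumes "iter_differentiable n f" "iter_differentiable n g"
  shows "iter_differentiable n (\<lambda>x. f x * g x)"
  using assms
proof (induction n arbitrary: f g)
  case (Suc n)
  note f = iter_differentiable_SucE[OF Suc.prems(1)] and g = iter_differentiable_SucE[OF Suc.prems(2)]
  have "iter_differentiable n (\<lambda>x. deriv f x * g x + deriv g x * f x)"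
    by (intro iter_differentiable_add Suc.IH f g Suc.prems[THEN iter_differentiable_Suc_imp])
  then show ?case
    by (rule iter_differentiable_SucI[rotated]) (intro DERIV_mult f g)
qed (simp add: iter_differentiable_0)

lemma iter_differentiable_exp:
  assumes "iter_differentiable n f"
  shows "iter_differentiable n (\<lambda>x. exp (f x))"
  using assms
proof (induction n)
  case (Suc n)
  note f = iter_differentiable_SucE[OF Suc.prems]
  have "iter_differentiable n (\<lambda>x. exp (f x) * deriv f x)"
    by (intro iter_differentiable_mult f Suc.IH Suc.prems[THEN iter_differentiable_Suc_imp])
  then show ?case
    by (rule iter_differentiable_SucI[rotated]) (auto intro!: derivative_eq_intros f)
qed (simp add: iter_differentiable_0)

text \<open>Sine and cosine are treated together because each is, up to sign, the derivative of the
  other.\<close>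

lemma iter_differentiable_sin_cos:
  "iter_differentiable n (\<lambda>x. sin (x - \<mu>)) \<and> iter_differentiable n (\<lambda>x. cos (x - \<mu>))"
proof (induction n)
  case (Suc n)
  have sin': "iter_differentiable n (\<lambda>x. (-1) * sin (x - \<mu>))"
    using Suc by (intro iter_differentiable_mult iter_differentiable_const) auto
  show ?case
  proof
    show "iter_differentiable (Suc n) (\<lambda>x. sin (x - \<mu>))"
      by (rule iter_differentiable_SucI[where f' = "\<lambda>x. cos (x - \<mu>)"])
         (use Suc in \<open>auto intro!: derivative_eq_intros\<close>)
    show "iter_differentiable (Suc n) (\<lambda>x. cos (x - \<mu>))"
      by (rule iter_differentiable_SucI[OF _ sin']) (auto intro!: derivative_eq_intros)
  qed
qed (simp add: iter_differentiable_0)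

lemma circle_smooth_iff:
  "circle_smooth f \<longleftrightarrow> (\<forall>n. iter_differentiable n f) \<and> (\<forall>x. f (x + 2 * pi) = f x)"
  unfolding circle_smooth_def iter_differentiable_def by blast

lemma circle_smooth_has_derivative:
  assumes "circle_smooth f"
  shows "(f has_real_derivative deriv f x) (at x)"
  using assms iter_differentiable_SucE(1) by (auto simp: circle_smooth_iff)

lemma circle_smooth_continuous:
  assumes "circle_smooth f"
  shows "continuous_on UNIV f"
  by (auto simp: continuous_on_eq_continuous_at
      intro!: DERIV_isCont[OF circle_smooth_has_derivative[OF assms]])

lemma circle_smooth_deriv:
  assumes "circle_smooth f"
  shows "circle_smooth (deriv f)"
proof -
  have "deriv f (x + 2 * pi) = deriv f x" for x
  proof (rule DERIV_unique)
    have "((\<lambda>y. f (y + 2 * pi)) has_real_derivative deriv f (x + 2 * pi)) (at x)"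
      using DERIV_shift[of f "deriv f (x + 2 * pi)" x "2*pi"]
        circle_smooth_has_derivative[OF assms, of "x + 2*pi"] by simp
    then show "(f has_real_derivative deriv f (x + 2 * pi)) (at x)"
      using assms by (simp add: circle_smooth_def)
  qed (rule circle_smooth_has_derivative[OF assms])
  then show ?thesis
    using assms iter_differentiable_SucE(2) by (auto simp: circle_smooth_iff)
qed

lemma circle_smooth_cmult:
  assumes "circle_smooth f"
  shows "circle_smooth (\<lambda>x. c * f x)"
  using assms by (auto simp: circle_smooth_iff intro!: iter_differentiable_mult iter_differentiable_const)

lemma circle_smooth_add:
  assumes "circle_smooth f" "circle_smooth g"
  shows "circle_smooth (\<lambda>x. f x + g x)"
  using assms by (auto simp: circle_smooth_iff intro!: iter_differentiable_add)

lemma circle_smooth_eq_0: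
  assumes r: "circle_smooth r" and z: "circle_integral (\<lambda>x. r x * r x) = 0"
  shows "r = (\<lambda>x. 0)"
proof
  fix x
  have c: "continuous_on UNIV (\<lambda>y. r y * r y)"
    by (intro continuous_intros circle_smooth_continuous r)
  \<comment> \<open>The number of full periods to remove so that x lands in the interval of
    integration, where positivity of the integral applies.\<close>
  define n where "n = \<lfloor>x / (2 * pi)\<rfloor>"
  have per: "r (y + 2 * pi * of_int k) = r y" for y k
  proof (induction k rule: int_induct[where k = 0])
    case (step1 i)
    have "r (y + 2 * pi * of_int i + 2 * pi) = r (y + 2 * pi * of_int i)"
      using r by (simp add: circle_smooth_def)
    with step1 show ?case by (simp add: algebra_simps)
  next
    case (step2 i)
    have "r (y + 2 * pi * of_int (i - 1) + 2 * pi) = r (y + 2 * pi * of_int (i - 1))"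
      using r by (simp add: circle_smooth_def)
    with step2 show ?case by (simp add: algebra_simps)
  qed simp
  have "x - 2 * pi * of_int n \<in> {0..2*pi}"
    using floor_divide_lower[of "2*pi" x] floor_divide_upper[of "2*pi" x]
    by (auto simp: n_def algebra_simps)
  then have "r (x - 2 * pi * of_int n) * r (x - 2 * pi * of_int n) = 0"
    using circle_integral_pos[OF c _ \<open>x - _ \<in> _\<close>] z by auto
  then show "r x = 0"
    using per[of "x - 2 * pi * of_int n" n] by simp
qed

text \<open>The difference of two candidates is itself a test function. Testing both with it makes
  the integral of its square zero.\<close>

lemma circle_adjoint_eqI:
  assumes r: "circle_smooth r"
    and adj: "\<And>f. circle_smooth f \<Longrightarrow>
      circle_integral (\<lambda>x. f x * r x) = circle_integral (\<lambda>x. T f x * p x)"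
  shows "circle_adjoint T p = r"
  unfolding circle_adjoint_def
proof (rule the_equality)
  fix s assume s: "circle_smooth s \<and> (\<forall>f. circle_smooth f \<longrightarrow>
      circle_integral (\<lambda>x. f x * s x) = circle_integral (\<lambda>x. T f x * p x))"
  define d where "d = (\<lambda>x. s x + (-1) * r x)"
  have d: "circle_smooth d"
    unfolding d_def using s r by (intro circle_smooth_add circle_smooth_cmult) auto
  have "circle_integral (\<lambda>x. d x * d x) = circle_integral (\<lambda>x. d x * s x - d x * r x)"
    by (simp add: d_def algebra_simps)
  also have "\<dots> = circle_integral (\<lambda>x. d x * s x) - circle_integral (\<lambda>x. d x * r x)"
    using s r d by (intro circle_integral_diff continuous_intros circle_smooth_continuous) auto
  also have "\<dots> = 0"
    using s adj[OF d] d by simp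
  finally have "d = (\<lambda>x. 0)"
    by (rule circle_smooth_eq_0[OF d])
  then show "s = r"
    by (auto simp: d_def fun_eq_iff)
qed (use r adj in auto)

text \<open>Periodicity makes the boundary terms cancel.\<close>

lemma circle_integral_by_parts:
  assumes f: "circle_smooth f" and g: "circle_smooth g"
  shows "circle_integral (\<lambda>x. deriv f x * g x) = - circle_integral (\<lambda>x. f x * deriv g x)"
proof -
  have "circle_integral (\<lambda>x. deriv f x * g x + f x * deriv g x) = 0"
  proof (rule circle_integral_derivative_eq_0)
    show "((\<lambda>x. f x * g x) has_real_derivative deriv f x * g x + f x * deriv g x) (at x)" for x
      by (auto intro!: derivative_eq_intros circle_smooth_has_derivative f g)
    show "f (2 * pi) * g (2 * pi) = f 0 * g 0"
      using f g by (metis add_0 circle_smooth_def)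
  qed
  moreover have "circle_integral (\<lambda>x. deriv f x * g x + f x * deriv g x) =
      circle_integral (\<lambda>x. deriv f x * g x) + circle_integral (\<lambda>x. f x * deriv g x)"
    by (intro circle_integral_add continuous_intros circle_smooth_continuous circle_smooth_deriv f g)
  ultimately show ?thesis by simp
qed

lemma circle_adjoint_ks_diffusion:
  assumes p: "circle_smooth p"
  shows "circle_adjoint (ks_diffusion k\<^sub>\<phi> k\<^sub>u) p = (\<lambda>x. - (k\<^sub>u / (k\<^sub>\<phi> + k\<^sub>u)) * deriv p x)"
proof (rule circle_adjoint_eqI)
  fix f assume f: "circle_smooth f"
  show "circle_integral (\<lambda>x. f x * (- (k\<^sub>u / (k\<^sub>\<phi> + k\<^sub>u)) * deriv p x)) =
      circle_integral (\<lambda>x. ks_diffusion k\<^sub>\<phi> k\<^sub>u f x * p x)"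
    using circle_integral_by_parts[OF f p]
      circle_integral_cmult[of "- (k\<^sub>u / (k\<^sub>\<phi> + k\<^sub>u))" "\<lambda>x. f x * deriv p x"]
      circle_integral_cmult[of "k\<^sub>u / (k\<^sub>\<phi> + k\<^sub>u)" "\<lambda>x. deriv f x * p x"]
    by (simp add: ks_diffusion_def mult_ac)
qed (intro circle_smooth_cmult circle_smooth_deriv p)

lemma circle_adjoint_ks_drift:
  assumes p: "circle_smooth p"
  shows "circle_adjoint (ks_drift k\<^sub>\<phi>) p = (\<lambda>x. 1 / (2 * k\<^sub>\<phi>) * deriv (deriv p) x)"
proof (rule circle_adjoint_eqI)
  fix f assume f: "circle_smooth f"
  have "circle_integral (\<lambda>x. f x * deriv (deriv p) x) = circle_integral (\<lambda>x. deriv (deriv f) x * p x)"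
    using circle_integral_by_parts[OF f circle_smooth_deriv[OF p]]
      circle_integral_by_parts[OF circle_smooth_deriv[OF f] p] by simp
  then show "circle_integral (\<lambda>x. f x * (1 / (2 * k\<^sub>\<phi>) * deriv (deriv p) x)) =
      circle_integral (\<lambda>x. ks_drift k\<^sub>\<phi> f x * p x)"
    using circle_integral_cmult[of "1 / (2 * k\<^sub>\<phi>)" "\<lambda>x. f x * deriv (deriv p) x"]
      circle_integral_cmult[of "1 / (2 * k\<^sub>\<phi>)" "\<lambda>x. deriv (deriv f) x * p x"]
    by (simp add: ks_drift_def mult_ac)
qed (intro circle_smooth_cmult circle_smooth_deriv p)

text \<open>With c = \<open>k\<^sub>u / (k\<^sub>\<phi> + k\<^sub>u)\<close>, the map
  \<open>B_dagger\<close> is -c d/dx on smooth functions. Being linear, it has itself as directional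
  derivative, so the correction is q/2 times its square, q c^2 p''/2. The result follows from q c^2
  = \<open>k\<^sub>u / (k\<^sub>\<phi> * (k\<^sub>\<phi> + k\<^sub>u))\<close>.\<close>

lemma A_dagger_eq:
  assumes p: "circle_smooth p" and k: "k\<^sub>\<phi> > 0" "k\<^sub>u > 0"
    and q: "quadratic_variation_rate M U = 1 / k\<^sub>\<phi> + 1 / k\<^sub>u"
  shows "A_dagger M U k\<^sub>\<phi> k\<^sub>u p = (\<lambda>x. 1 / (2 * (k\<^sub>\<phi> + k\<^sub>u)) * deriv (deriv p) x)"
proof
  fix x
  define c where "c = k\<^sub>u / (k\<^sub>\<phi> + k\<^sub>u)"
  have B: "B_dagger k\<^sub>\<phi> k\<^sub>u f = (\<lambda>x. - c * deriv f x)" if "circle_smooth f" for f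
    using circle_adjoint_ks_diffusion[OF that] by (simp add: B_dagger_def c_def)
  \<comment> \<open>The formula for the adjoint is available only at smooth arguments, so the
    perturbed density has to be shown smooth for every \<epsilon> before differentiating in
    \<epsilon>.\<close>
  have "B_dagger k\<^sub>\<phi> k\<^sub>u (\<lambda>y. p y + \<epsilon> * B_dagger k\<^sub>\<phi> k\<^sub>u p y) x =
      - c * (deriv p x + \<epsilon> * (- c * deriv (deriv p) x))" for \<epsilon>
  proof -
    have "deriv (\<lambda>y. p y + \<epsilon> * (- c * deriv p y)) x = deriv p x + \<epsilon> * (- c * deriv (deriv p) x)"
      by (rule DERIV_imp_deriv)
         (intro DERIV_add DERIV_cmult circle_smooth_has_derivative circle_smooth_deriv p)
    moreover have "circle_smooth (\<lambda>y. p y + \<epsilon> * (- c * deriv p y))"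
      by (intro circle_smooth_add circle_smooth_cmult circle_smooth_deriv p)
    ultimately show ?thesis
      by (simp only: B[OF p] B)
  qed
  then have "deriv (\<lambda>\<epsilon>. B_dagger k\<^sub>\<phi> k\<^sub>u (\<lambda>y. p y + \<epsilon> * B_dagger k\<^sub>\<phi> k\<^sub>u p y) x) 0 =
      c\<^sup>2 * deriv (deriv p) x"
    by (auto intro!: DERIV_imp_deriv derivative_eq_intros simp: power2_eq_square)
  then have "A_dagger M U k\<^sub>\<phi> k\<^sub>u p x =
      (1 / (2 * k\<^sub>\<phi>) - (1 / k\<^sub>\<phi> + 1 / k\<^sub>u) / 2 * c\<^sup>2) * deriv (deriv p) x"
    using circle_adjoint_ks_drift[OF p]
    by (simp add: A_dagger_def stratonovich_drift_def q algebra_simps)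
  also have "1 / (2 * k\<^sub>\<phi>) - (1 / k\<^sub>\<phi> + 1 / k\<^sub>u) / 2 * c\<^sup>2 =
      (1 / k\<^sub>\<phi> - (1 / k\<^sub>\<phi> + 1 / k\<^sub>u) * c\<^sup>2) / 2"
    by (simp add: diff_divide_distrib)
  also have "(1 / k\<^sub>\<phi> + 1 / k\<^sub>u) * c\<^sup>2 = k\<^sub>u / (k\<^sub>\<phi> * (k\<^sub>\<phi> + k\<^sub>u))"
    using k unfolding c_def power2_eq_square by (simp add: divide_simps)
  also have "1 / k\<^sub>\<phi> - k\<^sub>u / (k\<^sub>\<phi> * (k\<^sub>\<phi> + k\<^sub>u)) = 1 / (k\<^sub>\<phi> + k\<^sub>u)"
    using k by (simp add: divide_simps)
  also have "1 / (k\<^sub>\<phi> + k\<^sub>u) / 2 = 1 / (2 * (k\<^sub>\<phi> + k\<^sub>u))"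
    by simp
  finally show "A_dagger M U k\<^sub>\<phi> k\<^sub>u p x = 1 / (2 * (k\<^sub>\<phi> + k\<^sub>u)) * deriv (deriv p) x" .
qed

section \<open>Integral representations of the Bessel functions\<close>

text \<open>An unnormalised expectation under the von Mises law of mean 0; dividing by the moment of
  1 normalises it.\<close>

definition von_mises_moment :: "(real \<Rightarrow> real) \<Rightarrow> real \<Rightarrow> real" where
  "von_mises_moment g \<kappa> = circle_integral (\<lambda>x. g x * exp (\<kappa> * cos x))"

text \<open>Wallis recursion: the difference of the two integrands is the derivative of sin x
  cos^(n+1) x.\<close>

lemma circle_integral_cos_power_Suc_Suc:
  "real (n + 2) * circle_integral (\<lambda>x. cos x ^ (n + 2)) = real (n + 1) * circle_integral (\<lambda>x. cos x ^ n)"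
proof -
  have "circle_integral (\<lambda>x. real (n + 2) * cos x ^ (n + 2) - real (n + 1) * cos x ^ n) = 0"
  proof (rule circle_integral_derivative_eq_0)
    fix x :: real
    have "((\<lambda>x. sin x * cos x ^ (n + 1)) has_real_derivative
        cos x * cos x ^ (n + 1) - real (n + 1) * cos x ^ n * (sin x)\<^sup>2) (at x)"
      by (rule derivative_eq_intros refl)+ (simp add: power2_eq_square algebra_simps)
    also have "cos x * cos x ^ (n + 1) - real (n + 1) * cos x ^ n * (sin x)\<^sup>2 =
        real (n + 2) * cos x ^ (n + 2) - real (n + 1) * cos x ^ n"
      unfolding sin_squared_eq by (simp add: algebra_simps power2_eq_square)
    finally show "((\<lambda>x. sin x * cos x ^ (n + 1)) has_real_derivative
        real (n + 2) * cos x ^ (n + 2) - real (n + 1) * cos x ^ n) (at x)" .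
  qed simp
  then show ?thesis
    by (subst (asm) circle_integral_diff) (auto intro!: continuous_intros simp: circle_integral_cmult)
qed

lemma circle_integral_cos_power_even:
  "circle_integral (\<lambda>x. cos x ^ (2 * k)) = 2 * pi * fact (2 * k) / (4 ^ k * (fact k)\<^sup>2)"
proof (induction k)
  case 0
  show ?case by (simp add: circle_integral_def)
next
  case (Suc k)
  have "real (2 * k + 2) * circle_integral (\<lambda>x. cos x ^ (2 * k + 2)) =
      real (2 * k + 1) * (2 * pi * fact (2 * k) / (4 ^ k * (fact k)\<^sup>2))"
    using circle_integral_cos_power_Suc_Suc[of "2 * k"] Suc by simp
  then have "circle_integral (\<lambda>x. cos x ^ (2 * k + 2)) =
      real (2 * k + 1) * (2 * pi * fact (2 * k) / (4 ^ k * (fact k)\<^sup>2)) / real (2 * k + 2)"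
    by (subst nonzero_eq_divide_eq) (simp, simp only: mult.commute)
  also have "\<dots> = 2 * pi * fact (2 * Suc k) / (4 ^ Suc k * (fact (Suc k))\<^sup>2)"
    by (simp add: divide_simps power2_eq_square) (simp add: algebra_simps)
  finally show ?case by simp
qed

lemma circle_integral_cos_power_odd: "circle_integral (\<lambda>x. cos x ^ (2 * k + 1)) = 0"
proof (induction k)
  case 0
  have "circle_integral cos = 0"
    by (rule circle_integral_derivative_eq_0[of sin]) (auto intro!: derivative_eq_intros)
  then show ?case by simp
next
  case (Suc k)
  have "real (2 * k + 3) * circle_integral (\<lambda>x. cos x ^ (2 * k + 3)) = 0"
    using circle_integral_cos_power_Suc_Suc[of "2 * k + 1"] Suc by (simp add: numeral_3_eq_3)
  moreover have "real (2 * k + 3) \<noteq> 0" by linarith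
  ultimately show ?case by (simp add: numeral_3_eq_3)
qed

text \<open>The exponential series is integrated term by term; the majorant |\<kappa>|^n / n! makes
  it converge uniformly in x.\<close>

lemma von_mises_moment_cos_power_sums:
  "(\<lambda>n. \<kappa> ^ n / fact n * circle_integral (\<lambda>x. cos x ^ (n + m))) sums
     von_mises_moment (\<lambda>x. cos x ^ m) \<kappa>"
proof -
  define u where "u n x = cos x ^ m * ((\<kappa> * cos x) ^ n / fact n)" for n and x :: real
  define S where "S N x = (\<Sum>n<N. u n x)" for N and x :: real
  have "uniform_limit {0..2*pi} S (\<lambda>x. \<Sum>n. u n x) sequentially"
    unfolding S_def
  proof (rule Weierstrass_m_test)
    fix n and x :: real
    have "\<bar>cos x\<bar> ^ m \<le> 1" "\<bar>cos x\<bar> ^ n \<le> 1"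
      by (auto intro: power_le_one)
    then have "\<bar>cos x\<bar> ^ m * (\<bar>\<kappa>\<bar> ^ n * \<bar>cos x\<bar> ^ n / fact n) \<le> 1 * (\<bar>\<kappa>\<bar> ^ n * 1 / fact n)"
      by (intro mult_mono divide_right_mono mult_left_mono) auto
    then show "norm (u n x) \<le> \<bar>\<kappa>\<bar> ^ n / fact n"
      by (simp add: u_def abs_mult power_abs power_mult_distrib)
  next
    show "summable (\<lambda>n. \<bar>\<kappa>\<bar> ^ n / fact n)"
      using summable_exp[of "\<bar>\<kappa>\<bar>"] by (simp add: field_simps)
  qed
  moreover have "(\<Sum>n. u n x) = cos x ^ m * exp (\<kappa> * cos x)" for x
    using exp_converges[of "\<kappa> * cos x"] unfolding u_def
    by (intro sums_unique[symmetric] sums_mult) (simp add: field_simps)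
  ultimately have "uniform_limit {0..2*pi} S (\<lambda>x. cos x ^ m * exp (\<kappa> * cos x)) sequentially"
    by simp
  then obtain I J where I: "\<And>N. (S N has_integral I N) {0..2*pi}"
    and J: "((\<lambda>x. cos x ^ m * exp (\<kappa> * cos x)) has_integral J) {0..2*pi}" and IJ: "I \<longlonglongrightarrow> J"
    by (rule uniform_limit_integral)
       (auto simp: S_def u_def intro!: continuous_intros)
  have "J = von_mises_moment (\<lambda>x. cos x ^ m) \<kappa>"
    using J by (simp add: von_mises_moment_def circle_integral_def integral_unique)
  moreover have "I N = (\<Sum>n<N. \<kappa> ^ n / fact n * circle_integral (\<lambda>x. cos x ^ (n + m)))" for N
  proof -
    have u: "integral {0..2*pi} (u n) = \<kappa> ^ n / fact n * circle_integral (\<lambda>x. cos x ^ (n + m))" for n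
    proof -
      have "u n = (\<lambda>x. \<kappa> ^ n / fact n * cos x ^ (n + m))"
        by (auto simp: u_def power_mult_distrib power_add)
      then show ?thesis
        using circle_integral_cmult[of "\<kappa> ^ n / fact n"] by (simp add: circle_integral_def)
    qed
    have "I N = integral {0..2*pi} (S N)"
      by (rule integral_unique[OF I, symmetric])
    also have "\<dots> = (\<Sum>n<N. integral {0..2*pi} (u n))"
      unfolding S_def
      by (intro integral_sum) (auto simp: u_def intro!: integrable_continuous_real continuous_intros)
    finally show ?thesis
      by (simp only: u)
  qed
  then have "I = (\<lambda>N. \<Sum>n<N. \<kappa> ^ n / fact n * circle_integral (\<lambda>x. cos x ^ (n + m)))"
    by blast
  ultimately show ?thesis
    using IJ unfolding sums_def by simp
qed

text \<open>Odd powers of cosine integrate to zero, so only even indices survive. The summands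
  \<open>+ 0\<close> keep the shape of the series in \<open>bessel_I\<close> at order 0, so that
  both orders can be handled by one argument.\<close>

lemma von_mises_moment_1_bessel_sums:
  "(\<lambda>k. 2 * pi * ((\<kappa> / 2) ^ (2 * k + 0) / (fact k * fact (k + 0)))) sums von_mises_moment (\<lambda>x. 1) \<kappa>"
proof -
  let ?f = "\<lambda>n. \<kappa> ^ n / fact n * circle_integral (\<lambda>x. cos x ^ n)"
  have "?f sums von_mises_moment (\<lambda>x. 1) \<kappa>"
    using von_mises_moment_cos_power_sums[of \<kappa> 0] by simp
  moreover have "?f n = 0" if "n \<notin> range (\<lambda>k. 2 * k)" for n
  proof -
    have "odd n" using that by (auto elim!: evenE)
    then show ?thesis using circle_integral_cos_power_odd by (auto elim!: oddE)
  qed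
  ultimately have "(\<lambda>k. ?f (2 * k)) sums von_mises_moment (\<lambda>x. 1) \<kappa>"
    by (subst sums_mono_reindex) (auto simp: strict_mono_def)
  moreover have "?f (2 * k) = 2 * pi * ((\<kappa> / 2) ^ (2 * k + 0) / (fact k * fact (k + 0)))" for k
    unfolding circle_integral_cos_power_even
    by (simp add: power_divide power_mult power2_eq_square)
  ultimately show ?thesis by simp
qed

lemma von_mises_moment_cos_bessel_sums:
  "(\<lambda>k. 2 * pi * ((\<kappa> / 2) ^ (2 * k + 1) / (fact k * fact (k + 1)))) sums von_mises_moment cos \<kappa>"
proof -
  let ?f = "\<lambda>n. \<kappa> ^ n / fact n * circle_integral (\<lambda>x. cos x ^ (n + 1))"
  have "?f sums von_mises_moment cos \<kappa>"
    using von_mises_moment_cos_power_sums[of \<kappa> 1] by simp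
  moreover have "?f n = 0" if "n \<notin> range (\<lambda>k. 2 * k + 1)" for n
  proof -
    have "even n"
    proof (rule ccontr)
      assume "odd n"
      then obtain j where "n = 2 * j + 1" by (rule oddE)
      with that show False by auto
    qed
    then show ?thesis using circle_integral_cos_power_odd by (auto elim!: evenE)
  qed
  ultimately have "(\<lambda>k. ?f (2 * k + 1)) sums von_mises_moment cos \<kappa>"
    by (subst sums_mono_reindex) (auto simp: strict_mono_def)
  \<comment> \<open>At index 2k + 1 the integrand is the even power 2(k + 1) of cosine, which
    supplies the factorials of k + 1.\<close>
  moreover have "?f (2 * k + 1) = 2 * pi * ((\<kappa> / 2) ^ (2 * k + 1) / (fact k * fact (k + 1)))" for k
  proof -
    have "?f (2 * k + 1) = \<kappa> ^ (2 * k + 1) / fact (2 * k + 1) *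
        (2 * pi * fact (2 * Suc k) / (4 ^ Suc k * (fact (Suc k))\<^sup>2))"
      using circle_integral_cos_power_even[of "Suc k"] by simp
    also have "fact (2 * Suc k) = (2 * real (k + 1)) * fact (2 * k + 1)"
      by simp
    also have "(fact (Suc k) :: real)\<^sup>2 = real (k + 1) * fact k * fact (k + 1)"
      by (simp add: power2_eq_square)
    also have "\<kappa> ^ (2 * k + 1) / fact (2 * k + 1) * (2 * pi * (2 * real (k + 1) * fact (2 * k + 1)) /
        (4 ^ Suc k * (real (k + 1) * fact k * fact (k + 1)))) =
        2 * pi * (\<kappa> ^ (2 * k + 1) / (2 * 4 ^ k) / (fact k * fact (k + 1)))"
      by (simp add: divide_simps del: fact_Suc of_nat_Suc of_nat_add)
    also have "2 * 4 ^ k = (2::real) ^ (2 * k + 1)"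
      by (simp add: power_mult)
    finally show ?thesis
      by (simp only: power_divide)
  qed
  ultimately show ?thesis by simp
qed

text \<open>Convergence of the moment expansions also gives summability of the Bessel series, so
  positivity for \<kappa> > 0 can be read off term by term.\<close>

lemma bessel_I_0_eq: "2 * pi * bessel_I 0 \<kappa> = von_mises_moment (\<lambda>x. 1) \<kappa>"
  and bessel_I_1_eq: "2 * pi * bessel_I 1 \<kappa> = von_mises_moment cos \<kappa>"
  and bessel_I_1_pos: "\<kappa> > 0 \<Longrightarrow> bessel_I 1 \<kappa> > 0"
proof -
  have *: "bessel_I n \<kappa> = c / (2 * pi) \<and> (\<kappa> > 0 \<longrightarrow> bessel_I n \<kappa> > 0)"
    if "(\<lambda>k. 2 * pi * ((\<kappa> / 2) ^ (2 * k + n) / (fact k * fact (k + n)))) sums c" for n c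
  proof -
    have s: "(\<lambda>k. (\<kappa> / 2) ^ (2 * k + n) / (fact k * fact (k + n))) sums (c / (2 * pi))"
      using sums_divide[OF that, of "2 * pi"] by simp
    have "bessel_I n \<kappa> > 0" if "\<kappa> > 0"
      unfolding bessel_I_def using that by (intro suminf_pos sums_summable[OF s]) simp
    then show ?thesis
      using sums_unique[OF s] by (simp add: bessel_I_def)
  qed
  show "2 * pi * bessel_I 0 \<kappa> = von_mises_moment (\<lambda>x. 1) \<kappa>"
    using *[OF von_mises_moment_1_bessel_sums] by simp
  show "2 * pi * bessel_I 1 \<kappa> = von_mises_moment cos \<kappa>" "\<kappa> > 0 \<Longrightarrow> bessel_I 1 \<kappa> > 0"
    using *[OF von_mises_moment_cos_bessel_sums] by auto
qed

lemma von_mises_moment_1_pos: "von_mises_moment (\<lambda>x. 1) \<kappa> > 0"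
  unfolding von_mises_moment_def
  by (rule circle_integral_pos[of _ 0]) (auto intro!: continuous_intros)

text \<open>Read off from the integral of a positive function, so the density is positive and its
  logarithm differentiable at every parameter vector, not only inside the domain.\<close>

lemma bessel_I_0_pos: "bessel_I 0 \<kappa> > 0"
  using von_mises_moment_1_pos[of \<kappa>] bessel_I_0_eq[of \<kappa>]
  by (metis pi_gt_zero zero_less_mult_pos zero_less_numeral zero_less_mult_iff)

text \<open>Differentiation under the integral sign brings down a factor cos x, turning the
  representation of I_0 into that of I_1.\<close>

lemma bessel_I_0_has_derivative: "(bessel_I 0 has_real_derivative bessel_I 1 \<kappa>) (at \<kappa>)"
proof -
  have "((\<lambda>\<kappa>. integral (cbox 0 (2*pi)) (\<lambda>x. exp (\<kappa> * cos x))) has_real_derivative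
      integral (cbox 0 (2*pi)) (\<lambda>x. cos x * exp (\<kappa> * cos x))) (at \<kappa> within UNIV)"
    by (rule leibniz_rule_field_derivative)
       (auto intro!: derivative_eq_intros integrable_continuous_real continuous_intros
          simp: split_beta)
  then have "((\<lambda>\<kappa>. 2 * pi * bessel_I 0 \<kappa>) has_real_derivative 2 * pi * bessel_I 1 \<kappa>) (at \<kappa>)"
    unfolding bessel_I_0_eq bessel_I_1_eq by (simp add: von_mises_moment_def circle_integral_def)
  then have "((\<lambda>\<kappa>. 2 * pi * bessel_I 0 \<kappa> / (2 * pi)) has_real_derivative 2 * pi * bessel_I 1 \<kappa> / (2 * pi)) (at \<kappa>)"
    by (rule DERIV_cdivide)
  then show ?thesis by simp
qed

section \<open>Identities for moments with weight exp(\<kappa> cos x)\<close>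

lemma von_mises_moment_add:
  assumes "continuous_on UNIV f" "continuous_on UNIV g"
  shows "von_mises_moment (\<lambda>x. f x + g x) \<kappa> = von_mises_moment f \<kappa> + von_mises_moment g \<kappa>"
  unfolding von_mises_moment_def distrib_right
  by (intro circle_integral_add continuous_intros assms)

lemma von_mises_moment_cmult: "von_mises_moment (\<lambda>x. c * f x) \<kappa> = c * von_mises_moment f \<kappa>"
  unfolding von_mises_moment_def by (simp add: mult.assoc circle_integral_cmult)

lemma von_mises_moment_odd:
  assumes "\<And>x. g (2 * pi - x) = - g x"
  shows "von_mises_moment g \<kappa> = 0"
  unfolding von_mises_moment_def
  by (rule circle_integral_odd) (simp add: assms cos_diff)

text \<open>A Stein identity: differentiating the weight produces the factor -\<kappa> sin x.
  Choosing g = sin and g = sin cos yields the second and third moments needed later.\<close>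

lemma von_mises_moment_by_parts:
  assumes g: "\<And>x. (g has_real_derivative g' x) (at x)" and g': "continuous_on UNIV g'"
    and per: "g (2 * pi) = g 0"
  shows "von_mises_moment g' \<kappa> = \<kappa> * von_mises_moment (\<lambda>x. sin x * g x) \<kappa>"
proof -
  have c: "continuous_on UNIV g"
    using g by (auto simp: continuous_on_eq_continuous_at intro: DERIV_isCont)
  have "circle_integral (\<lambda>x. (g' x + - \<kappa> * (sin x * g x)) * exp (\<kappa> * cos x)) = 0"
    by (rule circle_integral_derivative_eq_0[of "\<lambda>x. g x * exp (\<kappa> * cos x)"])
       (auto intro!: derivative_eq_intros g simp: per[simplified mult.commute[of 2]] algebra_simps)
  then have "von_mises_moment (\<lambda>x. g' x + - \<kappa> * (sin x * g x)) \<kappa> = 0"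
    by (simp add: von_mises_moment_def)
  then show ?thesis
    by (subst (asm) von_mises_moment_add)
       (auto intro!: continuous_intros c g' simp: von_mises_moment_cmult[of "- \<kappa>", simplified])
qed

section \<open>Projection onto the von Mises family\<close>

text \<open>The parameter derivatives of the log density as functions of the centred angle x -
  \<mu>. The subtracted ratio I_1/I_0 is the derivative of ln I_0, from the normalising
  constant.\<close>

definition score :: "2 \<Rightarrow> real \<Rightarrow> real \<Rightarrow> real" where
  "score i \<kappa> x = (if i = 1 then \<kappa> * sin x else cos x - bessel_ratio \<kappa>)"

lemma bessel_ratio_eq: "bessel_ratio \<kappa> = von_mises_moment cos \<kappa> / von_mises_moment (\<lambda>x. 1) \<kappa>"
  unfolding bessel_ratio_def bessel_I_0_eq[symmetric] bessel_I_1_eq[symmetric] by simp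

lemma bessel_ratio_pos: "\<kappa> > 0 \<Longrightarrow> bessel_ratio \<kappa> > 0"
  by (simp add: bessel_ratio_def bessel_I_0_pos bessel_I_1_pos[unfolded One_nat_def])

lemma von_mises_moment_sin_squared:
  assumes "\<kappa> \<noteq> 0"
  shows "von_mises_moment (\<lambda>x. sin x * sin x) \<kappa> = von_mises_moment cos \<kappa> / \<kappa>"
proof -
  have "von_mises_moment cos \<kappa> = \<kappa> * von_mises_moment (\<lambda>x. sin x * sin x) \<kappa>"
    by (rule von_mises_moment_by_parts) (auto intro!: continuous_intros)
  then show ?thesis
    using assms by simp
qed

lemma von_mises_moment_cos_squared:
  assumes "\<kappa> \<noteq> 0"
  shows "von_mises_moment (\<lambda>x. cos x * cos x) \<kappa> =
    von_mises_moment (\<lambda>x. 1) \<kappa> - von_mises_moment cos \<kappa> / \<kappa>"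
proof -
  have "von_mises_moment (\<lambda>x. cos x * cos x + sin x * sin x) \<kappa> =
      von_mises_moment (\<lambda>x. cos x * cos x) \<kappa> + von_mises_moment (\<lambda>x. sin x * sin x) \<kappa>"
    by (intro von_mises_moment_add continuous_intros)
  also have "(\<lambda>x::real. cos x * cos x + sin x * sin x) = (\<lambda>x. 1)"
    by (simp flip: power2_eq_square)
  finally show ?thesis
    using von_mises_moment_sin_squared[OF assms] by simp
qed

lemma von_mises_moment_sin_squared_cos:
  assumes "\<kappa> \<noteq> 0"
  shows "von_mises_moment (\<lambda>x. sin x * (sin x * cos x)) \<kappa> =
    (von_mises_moment (\<lambda>x. 1) \<kappa> - 2 * von_mises_moment cos \<kappa> / \<kappa>) / \<kappa>"
proof -
  have "von_mises_moment (\<lambda>x. cos x * cos x + (-1) * (sin x * sin x)) \<kappa> =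
      \<kappa> * von_mises_moment (\<lambda>x. sin x * (sin x * cos x)) \<kappa>"
    by (rule von_mises_moment_by_parts) (auto intro!: derivative_eq_intros continuous_intros)
  moreover have "von_mises_moment (\<lambda>x. cos x * cos x + (-1) * (sin x * sin x)) \<kappa> =
      von_mises_moment (\<lambda>x. cos x * cos x) \<kappa> + (-1) * von_mises_moment (\<lambda>x. sin x * sin x) \<kappa>"
    unfolding von_mises_moment_cmult[symmetric]
    by (intro von_mises_moment_add continuous_intros)
  ultimately have "\<kappa> * von_mises_moment (\<lambda>x. sin x * (sin x * cos x)) \<kappa> =
      von_mises_moment (\<lambda>x. 1) \<kappa> - 2 * von_mises_moment cos \<kappa> / \<kappa>"
    unfolding von_mises_moment_sin_squared[OF assms] von_mises_moment_cos_squared[OF assms] by linarith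
  then show ?thesis
    using assms by (simp add: nonzero_eq_divide_eq mult.commute)
qed

section \<open>The von Mises density and its derivatives in angle and parameters\<close>

lemma von_mises_pos: "von_mises \<theta> x > 0"
  by (simp add: von_mises_def bessel_I_0_pos)

lemma circle_smooth_von_mises: "circle_smooth (von_mises \<theta>)"
proof -
  have "circle_smooth (\<lambda>x. 1 / (2 * pi * bessel_I 0 (\<theta> $ 2)) * exp (\<theta> $ 2 * cos (x - \<theta> $ 1)))"
    unfolding circle_smooth_iff
  proof safe
    show "iter_differentiable n (\<lambda>x. 1 / (2 * pi * bessel_I 0 (\<theta> $ 2)) * exp (\<theta> $ 2 * cos (x - \<theta> $ 1)))" for n
      by (intro iter_differentiable_mult iter_differentiable_const iter_differentiable_exp
          iter_differentiable_sin_cos[THEN conjunct2])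
    show "1 / (2 * pi * bessel_I 0 (\<theta> $ 2)) * exp (\<theta> $ 2 * cos (x + 2 * pi - \<theta> $ 1)) =
        1 / (2 * pi * bessel_I 0 (\<theta> $ 2)) * exp (\<theta> $ 2 * cos (x - \<theta> $ 1))" for x
      using cos_periodic[of "x - \<theta> $ 1"] by (simp add: algebra_simps)
  qed
  then show ?thesis
    by (simp add: von_mises_def[abs_def])
qed

lemma deriv_von_mises: "deriv (von_mises \<theta>) = (\<lambda>x. - (\<theta> $ 2) * sin (x - \<theta> $ 1) * von_mises \<theta> x)"
  unfolding von_mises_def[abs_def]
  using bessel_I_0_pos[of "\<theta> $ 2"]
  by (intro ext DERIV_imp_deriv) (auto intro!: derivative_eq_intros)

lemma deriv_deriv_von_mises:
  "deriv (deriv (von_mises \<theta>)) =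
     (\<lambda>x. ((\<theta> $ 2)\<^sup>2 * (sin (x - \<theta> $ 1))\<^sup>2 - \<theta> $ 2 * cos (x - \<theta> $ 1)) * von_mises \<theta> x)"
proof
  fix x
  have vm: "(von_mises \<theta> has_real_derivative - (\<theta> $ 2) * sin (x - \<theta> $ 1) * von_mises \<theta> x) (at x)"
    using circle_smooth_has_derivative[OF circle_smooth_von_mises, of \<theta> x] by (simp add: deriv_von_mises)
  show "deriv (deriv (von_mises \<theta>)) x =
      ((\<theta> $ 2)\<^sup>2 * (sin (x - \<theta> $ 1))\<^sup>2 - \<theta> $ 2 * cos (x - \<theta> $ 1)) * von_mises \<theta> x"
    unfolding deriv_von_mises
    by (rule DERIV_imp_deriv)
       (auto intro!: derivative_eq_intros vm simp: power2_eq_square algebra_simps)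
qed

lemma param_has_derivative_ln_von_mises:
  "((\<lambda>s. ln (von_mises (\<chi> j. if j = i then s else \<theta> $ j) x)) has_real_derivative
     score i (\<theta> $ 2) (x - \<theta> $ 1)) (at (\<theta> $ i))"
proof -
  have ln_eq: "ln (von_mises \<eta> x) = \<eta> $ 2 * cos (x - \<eta> $ 1) - ln (2 * pi * bessel_I 0 (\<eta> $ 2))" for \<eta>
    using bessel_I_0_pos[of "\<eta> $ 2"] by (simp add: von_mises_def ln_mult ln_div)
  consider "i = 1" | "i = 2" using exhaust_2[of i] by blast
  then show ?thesis
  proof cases
    case 1
    then show ?thesis
      unfolding ln_eq by (auto intro!: derivative_eq_intros simp: score_def)
  next
    case 2
    have "((\<lambda>s. s * cos (x - \<theta> $ 1) - ln (2 * pi * bessel_I 0 s)) has_real_derivative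
        cos (x - \<theta> $ 1) - 1 / (2 * pi * bessel_I 0 (\<theta> $ 2)) * (2 * pi * bessel_I 1 (\<theta> $ 2))) (at (\<theta> $ 2))"
      using bessel_I_0_pos[of "\<theta> $ 2"]
      by (auto intro!: derivative_eq_intros bessel_I_0_has_derivative)
    then show ?thesis
      unfolding ln_eq using 2 by (simp add: score_def bessel_ratio_def)
  qed
qed

lemma param_deriv_ln_von_mises:
  "param_deriv i (\<lambda>\<eta>. ln (von_mises \<eta> x)) \<theta> = score i (\<theta> $ 2) (x - \<theta> $ 1)"
  unfolding param_deriv_def by (rule DERIV_imp_deriv[OF param_has_derivative_ln_von_mises])

text \<open>Writing the positive density as the exponential of its logarithm reduces this to the
  logarithmic derivative.\<close>

lemma param_deriv_von_mises:
  "param_deriv i (\<lambda>\<eta>. von_mises \<eta> x) \<theta> = score i (\<theta> $ 2) (x - \<theta> $ 1) * von_mises \<theta> x"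
proof -
  have "(\<chi> j. if j = i then \<theta> $ i else \<theta> $ j) = \<theta>"
    by (simp add: vec_eq_iff)
  then have "((\<lambda>s. exp (ln (von_mises (\<chi> j. if j = i then s else \<theta> $ j) x))) has_real_derivative
     von_mises \<theta> x * score i (\<theta> $ 2) (x - \<theta> $ 1)) (at (\<theta> $ i))"
    using DERIV_chain2[OF DERIV_exp param_has_derivative_ln_von_mises[of i \<theta> x]]
    by (simp add: von_mises_pos)
  then show ?thesis
    unfolding param_deriv_def by (intro DERIV_imp_deriv) (simp add: von_mises_pos mult.commute)
qed

text \<open>Translation by \<mu> removes the mean, so metric and pairings depend on \<kappa>
  alone.\<close>

lemma circle_integral_von_mises:
  assumes "continuous_on UNIV g" "\<And>x. g (x + 2 * pi) = g x"
  shows "circle_integral (\<lambda>x. g (x - \<theta> $ 1) * von_mises \<theta> x) =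
    von_mises_moment g (\<theta> $ 2) / von_mises_moment (\<lambda>x. 1) (\<theta> $ 2)"
proof -
  have "circle_integral (\<lambda>x. g (x - \<theta> $ 1) * von_mises \<theta> x) =
      circle_integral (\<lambda>x. 1 / von_mises_moment (\<lambda>x. 1) (\<theta> $ 2) *
        (\<lambda>y. g y * exp (\<theta> $ 2 * cos y)) (x - \<theta> $ 1))"
    unfolding von_mises_def bessel_I_0_eq by (simp add: mult_ac)
  also have "\<dots> = 1 / von_mises_moment (\<lambda>x. 1) (\<theta> $ 2) * von_mises_moment g (\<theta> $ 2)"
    unfolding circle_integral_cmult von_mises_moment_def[of g]
    by (subst circle_integral_shift) (auto intro!: continuous_intros assms(1) simp: assms(2))
  finally show ?thesis by simp
qed

lemma score_periodic: "score i \<kappa> (x + 2 * pi) = score i \<kappa> x"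
  by (simp add: score_def)

lemma continuous_on_score: "continuous_on UNIV (score i \<kappa>)"
  unfolding score_def[abs_def] by (cases "i = 1") (auto intro!: continuous_intros)

lemma fisher_metric_von_mises:
  "fisher_metric von_mises \<theta> $ i $ j =
     von_mises_moment (\<lambda>x. score i (\<theta> $ 2) x * score j (\<theta> $ 2) x) (\<theta> $ 2) /
     von_mises_moment (\<lambda>x. 1) (\<theta> $ 2)"
  unfolding fisher_metric_def param_deriv_ln_von_mises vec_lambda_beta
  by (rule circle_integral_von_mises)
     (simp_all add: score_periodic continuous_on_mult continuous_on_score)

lemma density_inner_von_mises:
  assumes "continuous_on UNIV z" "\<And>x. z (x + 2 * pi) = z x"
  shows "density_inner (von_mises \<theta>) (\<lambda>x. z (x - \<theta> $ 1) * von_mises \<theta> x)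
      (\<lambda>x. param_deriv i (\<lambda>\<eta>. von_mises \<eta> x) \<theta>) =
    von_mises_moment (\<lambda>x. z x * score i (\<theta> $ 2) x) (\<theta> $ 2) / von_mises_moment (\<lambda>x. 1) (\<theta> $ 2)"
proof -
  have "density_inner (von_mises \<theta>) (\<lambda>x. z (x - \<theta> $ 1) * von_mises \<theta> x)
      (\<lambda>x. param_deriv i (\<lambda>\<eta>. von_mises \<eta> x) \<theta>) =
      circle_integral (\<lambda>x. (\<lambda>y. z y * score i (\<theta> $ 2) y) (x - \<theta> $ 1) * von_mises \<theta> x)"
    unfolding density_inner_def param_deriv_von_mises
    using von_mises_pos[of \<theta>, THEN less_imp_neq] by (simp add: mult_ac)
  also have "\<dots> = von_mises_moment (\<lambda>x. z x * score i (\<theta> $ 2) x) (\<theta> $ 2) /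
      von_mises_moment (\<lambda>x. 1) (\<theta> $ 2)"
    by (rule circle_integral_von_mises)
       (simp_all add: score_periodic continuous_on_mult continuous_on_score assms)
  finally show ?thesis .
qed

text \<open>\<open>matrix_inv\<close> picks some two-sided inverse, so the explicit one must be
  shown to be the only one: C = C(AB) = (CA)B = B.\<close>

lemma matrix_inv_diagonal_2:
  fixes A :: "real ^ 2 ^ 2"
  assumes off: "A $ 1 $ 2 = 0" "A $ 2 $ 1 = 0" and diag: "A $ 1 $ 1 \<noteq> 0" "A $ 2 $ 2 \<noteq> 0"
  shows "matrix_inv A = (\<chi> i j. if i = j then 1 / A $ i $ i else 0)" (is "_ = ?B")
proof -
  have AB: "A ** ?B = mat 1" "?B ** A = mat 1"
    using assms by (auto simp: vec_eq_iff forall_2 matrix_matrix_mult_def sum_2 mat_def)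
  show ?thesis
    unfolding matrix_inv_def
  proof (rule some_equality)
    fix C assume "A ** C = mat 1 \<and> C ** A = mat 1"
    then have "C = C ** (A ** ?B)" and "C ** A ** ?B = ?B"
      by (simp_all add: AB(1) matrix_mul_rid matrix_mul_lid)
    then show "C = ?B"
      by (simp only: matrix_mul_assoc)
  qed (use AB in auto)
qed

section \<open>Moments of the scores at a fixed positive precision\<close>

context
  fixes \<kappa> :: real
  assumes \<kappa>: "\<kappa> > 0"
begin

lemma von_mises_moment_score_1_1:
  "von_mises_moment (\<lambda>x. score 1 \<kappa> x * score 1 \<kappa> x) \<kappa> / von_mises_moment (\<lambda>x. 1) \<kappa> =
     \<kappa> * bessel_ratio \<kappa>"
proof -
  have "von_mises_moment (\<lambda>x. score 1 \<kappa> x * score 1 \<kappa> x) \<kappa> =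
      \<kappa>\<^sup>2 * von_mises_moment (\<lambda>x. sin x * sin x) \<kappa>"
    unfolding von_mises_moment_cmult[symmetric] by (simp add: score_def power2_eq_square mult_ac)
  then show ?thesis
    using \<kappa> by (simp add: von_mises_moment_sin_squared bessel_ratio_eq power2_eq_square)
qed

lemma von_mises_moment_score_1_2:
  "von_mises_moment (\<lambda>x. score 1 \<kappa> x * score 2 \<kappa> x) \<kappa> = 0"
  by (rule von_mises_moment_odd) (simp add: score_def sin_diff cos_diff)

text \<open>This is the variance of cosine, E[cos^2] - F^2, with E[cos^2] = 1 - F/\<kappa>.\<close>

lemma von_mises_moment_score_2_2:
  "von_mises_moment (\<lambda>x. score 2 \<kappa> x * score 2 \<kappa> x) \<kappa> / von_mises_moment (\<lambda>x. 1) \<kappa> =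
     1 - bessel_ratio \<kappa> / \<kappa> - (bessel_ratio \<kappa>)\<^sup>2"
proof -
  let ?F = "bessel_ratio \<kappa>" and ?M = "\<lambda>g. von_mises_moment g \<kappa>"
  have "?M (\<lambda>x. score 2 \<kappa> x * score 2 \<kappa> x) =
      ?M (\<lambda>x. (cos x * cos x + (- 2 * ?F) * cos x) + ?F\<^sup>2 * 1)"
    by (simp add: score_def power2_eq_square algebra_simps)
  also have "\<dots> = ?M (\<lambda>x. cos x * cos x) + (- 2 * ?F) * ?M cos + ?F\<^sup>2 * ?M (\<lambda>x. 1)"
    by (simp only: von_mises_moment_add von_mises_moment_cmult continuous_intros)
  also have "\<dots> / ?M (\<lambda>x. 1) = 1 - ?F / \<kappa> - ?F\<^sup>2"
    using \<kappa> von_mises_moment_1_pos[of \<kappa>]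
    by (simp add: von_mises_moment_cos_squared bessel_ratio_eq field_simps power2_eq_square)
  finally show ?thesis .
qed

lemma precision_decay_denominator_pos: "1 - bessel_ratio \<kappa> / \<kappa> - (bessel_ratio \<kappa>)\<^sup>2 > 0"
proof -
  have "von_mises_moment (\<lambda>x. score 2 \<kappa> x * score 2 \<kappa> x) \<kappa> > 0"
    unfolding von_mises_moment_def
    \<comment> \<open>At \<pi> the score is -1 - F(\<kappa>), which is nonzero because F(\<kappa>) >
      0.\<close>
    by (rule circle_integral_pos[of _ pi])
       (use bessel_ratio_pos[OF \<kappa>] in \<open>auto intro!: continuous_intros continuous_on_score simp: score_def\<close>)
  then show ?thesis
    unfolding von_mises_moment_score_2_2[symmetric] by (simp add: von_mises_moment_1_pos)
qed

lemma von_mises_moment_second_derivative_score_1: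
  "von_mises_moment (\<lambda>x. (a * (\<kappa>\<^sup>2 * (sin x)\<^sup>2 - \<kappa> * cos x)) * score 1 \<kappa> x) \<kappa> = 0"
  by (rule von_mises_moment_odd) (simp add: score_def sin_diff cos_diff)

text \<open>The bracket is p''/p in the centred angle. Its mean is zero, so the constant -F in the
  score contributes nothing; what remains is \<kappa>^2 E[sin^2 cos] - \<kappa> E[cos^2] = (\<kappa>
  - 2F) - (\<kappa> - F) = -F.\<close>

lemma von_mises_moment_second_derivative_score_2:
  "von_mises_moment (\<lambda>x. (a * (\<kappa>\<^sup>2 * (sin x)\<^sup>2 - \<kappa> * cos x)) * score 2 \<kappa> x) \<kappa> /
     von_mises_moment (\<lambda>x. 1) \<kappa> = - a * bessel_ratio \<kappa>"
proof -
  let ?F = "bessel_ratio \<kappa>" and ?M = "\<lambda>g. von_mises_moment g \<kappa>"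
  have "?M (\<lambda>x. (a * (\<kappa>\<^sup>2 * (sin x)\<^sup>2 - \<kappa> * cos x)) * score 2 \<kappa> x) =
      ?M (\<lambda>x. ((a * \<kappa>\<^sup>2 * (sin x * (sin x * cos x)) + (- a * \<kappa>\<^sup>2 * ?F) * (sin x * sin x)) +
                 (- a * \<kappa>) * (cos x * cos x)) + (a * \<kappa> * ?F) * cos x)"
    by (simp add: score_def power2_eq_square algebra_simps)
  also have "\<dots> = a * \<kappa>\<^sup>2 * ?M (\<lambda>x. sin x * (sin x * cos x)) + (- a * \<kappa>\<^sup>2 * ?F) * ?M (\<lambda>x. sin x * sin x) +
      (- a * \<kappa>) * ?M (\<lambda>x. cos x * cos x) + (a * \<kappa> * ?F) * ?M cos"
    by (simp only: von_mises_moment_add von_mises_moment_cmult continuous_intros)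
  also have "\<dots> = - a * ?M cos"
    unfolding von_mises_moment_sin_squared_cos[OF \<kappa>[THEN less_imp_neq, symmetric]]
      von_mises_moment_sin_squared[OF \<kappa>[THEN less_imp_neq, symmetric]]
      von_mises_moment_cos_squared[OF \<kappa>[THEN less_imp_neq, symmetric]]
    using \<kappa> by (simp add: field_simps power2_eq_square)
  finally show ?thesis
    by (simp add: bessel_ratio_eq)
qed

end

text \<open>Here z is the value of the field relative to the density, in the centred angle. As the
  metric is diagonal, each coordinate is its pairing \<open>m i\<close> divided by one metric
  coefficient.\<close>

lemma projected_field_von_mises:
  assumes \<theta>: "\<theta> $ 2 > 0" and z: "continuous_on UNIV z" "\<And>x. z (x + 2 * pi) = z x"
    and T: "T (von_mises \<theta>) = (\<lambda>x. z (x - \<theta> $ 1) * von_mises \<theta> x)"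
  defines "m i \<equiv> von_mises_moment (\<lambda>x. z x * score i (\<theta> $ 2) x) (\<theta> $ 2) /
    von_mises_moment (\<lambda>x. 1) (\<theta> $ 2)"
  shows "projected_field von_mises T \<theta> =
    vector [m 1 / (\<theta> $ 2 * bessel_ratio (\<theta> $ 2)),
            m 2 / (1 - bessel_ratio (\<theta> $ 2) / \<theta> $ 2 - (bessel_ratio (\<theta> $ 2))\<^sup>2)]"
proof -
  let ?A = "fisher_metric von_mises \<theta>" and ?F = "bessel_ratio (\<theta> $ 2)"
  have A: "?A $ 1 $ 1 = \<theta> $ 2 * ?F" "?A $ 1 $ 2 = 0" "?A $ 2 $ 1 = 0"
      "?A $ 2 $ 2 = 1 - ?F / \<theta> $ 2 - ?F\<^sup>2"
    unfolding fisher_metric_von_mises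
    using von_mises_moment_score_1_1[OF \<theta>] von_mises_moment_score_1_2[OF \<theta>]
      von_mises_moment_score_2_2[OF \<theta>] by (simp_all add: mult.commute[of "score 2 _ _" "score 1 _ _"])
  have inv: "matrix_inv ?A = (\<chi> i j. if i = j then 1 / ?A $ i $ i else 0)"
    using A bessel_ratio_pos[OF \<theta>] precision_decay_denominator_pos[OF \<theta>] \<theta>
    by (intro matrix_inv_diagonal_2) auto
  have m: "density_inner (von_mises \<theta>) (\<lambda>x. z (x - \<theta> $ 1) * von_mises \<theta> x)
      (\<lambda>x. param_deriv i (\<lambda>\<eta>. von_mises \<eta> x) \<theta>) = m i" for i
    unfolding m_def by (rule density_inner_von_mises[OF z])
  have "projected_field von_mises T \<theta> $ j = 1 / ?A $ j $ j * m j" for j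
    unfolding projected_field_def inv T m
    by (simp add: if_distrib[of "\<lambda>a. a * _"] cong: if_cong)
  then show ?thesis
    by (simp add: vec_eq_iff forall_2 A)
qed

lemma projected_field_von_mises_A_dagger:
  assumes "\<theta> $ 2 > 0" "k\<^sub>\<phi> > 0" "k\<^sub>u > 0" "quadratic_variation_rate M U = 1 / k\<^sub>\<phi> + 1 / k\<^sub>u"
  shows "projected_field von_mises (A_dagger M U k\<^sub>\<phi> k\<^sub>u) \<theta> =
    vector [0, - 1 / (2 * (k\<^sub>\<phi> + k\<^sub>u)) * precision_decay (\<theta> $ 2)]"
proof -
  define a where "a = 1 / (2 * (k\<^sub>\<phi> + k\<^sub>u))"
  have T: "A_dagger M U k\<^sub>\<phi> k\<^sub>u (von_mises \<theta>) =
      (\<lambda>x. (\<lambda>y. a * ((\<theta> $ 2)\<^sup>2 * (sin y)\<^sup>2 - \<theta> $ 2 * cos y)) (x - \<theta> $ 1) * von_mises \<theta> x)"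
    using A_dagger_eq[OF circle_smooth_von_mises assms(2-4), of \<theta>]
    by (simp add: deriv_deriv_von_mises a_def mult.assoc)
  have "projected_field von_mises (A_dagger M U k\<^sub>\<phi> k\<^sub>u) \<theta> =
      vector [0 / (\<theta> $ 2 * bessel_ratio (\<theta> $ 2)),
        - a * bessel_ratio (\<theta> $ 2) /
          (1 - bessel_ratio (\<theta> $ 2) / \<theta> $ 2 - (bessel_ratio (\<theta> $ 2))\<^sup>2)]"
    by (subst projected_field_von_mises[where z = "\<lambda>y. a * ((\<theta> $ 2)\<^sup>2 * (sin y)\<^sup>2 - \<theta> $ 2 * cos y)"
          and \<theta> = \<theta> and T = "A_dagger M U k\<^sub>\<phi> k\<^sub>u", OF assms(1) _ _ T])
       (auto intro!: continuous_intros
         simp only: von_mises_moment_second_derivative_score_1[OF assms(1)]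
         von_mises_moment_second_derivative_score_2[OF assms(1)] sin_periodic cos_periodic div_0)
  then show ?thesis
    by (simp add: a_def precision_decay_def)
qed

lemma projected_field_von_mises_B_dagger:
  assumes "\<theta> $ 2 > 0"
  shows "projected_field von_mises (B_dagger k\<^sub>\<phi> k\<^sub>u) \<theta> = vector [k\<^sub>u / (k\<^sub>\<phi> + k\<^sub>u), 0]"
proof -
  define c where "c = k\<^sub>u / (k\<^sub>\<phi> + k\<^sub>u)"
  have T: "B_dagger k\<^sub>\<phi> k\<^sub>u (von_mises \<theta>) =
      (\<lambda>x. (\<lambda>y. c * score 1 (\<theta> $ 2) y) (x - \<theta> $ 1) * von_mises \<theta> x)"
    using circle_adjoint_ks_diffusion[OF circle_smooth_von_mises, of k\<^sub>\<phi> k\<^sub>u \<theta>]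
    by (simp add: B_dagger_def deriv_von_mises c_def score_def mult.assoc)
  have m: "von_mises_moment (\<lambda>x. c * score 1 (\<theta> $ 2) x * score i (\<theta> $ 2) x) (\<theta> $ 2) =
      c * von_mises_moment (\<lambda>x. score 1 (\<theta> $ 2) x * score i (\<theta> $ 2) x) (\<theta> $ 2)" for i
    by (simp only: mult.assoc von_mises_moment_cmult)
  have "projected_field von_mises (B_dagger k\<^sub>\<phi> k\<^sub>u) \<theta> =
      vector [c * (von_mises_moment (\<lambda>x. score 1 (\<theta> $ 2) x * score 1 (\<theta> $ 2) x) (\<theta> $ 2) /
        von_mises_moment (\<lambda>x. 1) (\<theta> $ 2)) / (\<theta> $ 2 * bessel_ratio (\<theta> $ 2)), 0]"
    by (subst projected_field_von_mises[where z = "\<lambda>y. c * score 1 (\<theta> $ 2) y" and \<theta> = \<theta>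
          and T = "B_dagger k\<^sub>\<phi> k\<^sub>u", OF assms _ _ T])
       (simp_all add: continuous_on_mult continuous_on_score score_periodic m
         von_mises_moment_score_1_2[OF assms])
  then show ?thesis
    using assms bessel_ratio_pos[OF assms]
    by (simp add: von_mises_moment_score_1_1[OF assms] c_def del: times_divide_eq_right)
qed

section \<open>Quadratic variation of the observations\<close>

lemma (in prob_space) sigma_sets_vimage_subset:
  assumes "X \<in> measurable (sigma (space M) G) N" "G \<subseteq> Pow (space M)"
  shows "sigma_sets (space M) {X -` A \<inter> space M | A. A \<in> sets N} \<subseteq> sigma_sets (space M) G"
proof -
  have "{X -` A \<inter> space M | A. A \<in> sets N} \<subseteq> sigma_sets (space M) G"
    using measurable_sets[OF assms(1)] assms(2) by (auto simp: space_measure_of_conv)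
  then show ?thesis
    by (rule sigma_sets_mono)
qed

lemma increment_measurable_process_events:
  fixes X :: "real \<Rightarrow> 'a \<Rightarrow> real"
  assumes "0 \<le> s" "0 \<le> t"
  shows "(\<lambda>\<omega>. X t \<omega> - X s \<omega>) \<in> borel_measurable
    (sigma (space M) {X s -` B \<inter> space M | s B. 0 \<le> s \<and> B \<in> sets borel})"
proof -
  let ?G = "{X s -` B \<inter> space M | s B. 0 \<le> s \<and> B \<in> sets borel}"
  have G: "?G \<subseteq> Pow (space M)" by auto
  have "X r \<in> borel_measurable (sigma (space M) ?G)" if "0 \<le> r" for r
  proof (rule measurableI)
    fix B :: "real set" assume "B \<in> sets borel"
    with that have "X r -` B \<inter> space M \<in> ?G" by blast
    then show "X r -` B \<inter> space (sigma (space M) ?G) \<in> sets (sigma (space M) ?G)"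
      using G by (simp add: space_measure_of sigma_sets.Basic)
  qed simp
  then show ?thesis
    using assms by (intro borel_measurable_diff)
qed

text \<open>An increment generates a sub-sigma-algebra of the events of its process, and
  independence passes to smaller families.\<close>

lemma (in prob_space) indep_increments_of_independent_processes:
  assumes indep: "independent_processes M X Y"
    and X: "\<And>t. 0 \<le> t \<Longrightarrow> X t \<in> borel_measurable M" and Y: "\<And>t. 0 \<le> t \<Longrightarrow> Y t \<in> borel_measurable M"
    and st: "0 \<le> s" "0 \<le> t"
  shows "indep_var borel (\<lambda>\<omega>. X t \<omega> - X s \<omega>) borel (\<lambda>\<omega>. Y t \<omega> - Y s \<omega>)"
proof -
  have sub: "sigma_sets (space M) {(\<lambda>\<omega>. Z t \<omega> - Z s \<omega>) -` A \<inter> space M | A. A \<in> sets borel}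
      \<subseteq> process_events M Z" for Z
    unfolding process_events_def
    by (rule sigma_sets_vimage_subset[OF increment_measurable_process_events]) (use st in auto)
  show ?thesis
    unfolding indep_var_eq
    using indep sub[of X] sub[of Y] X Y st
    unfolding independent_processes_def indep_sets2_eq by (auto 4 3)
qed

lemma (in prob_space) distributed_normal_moments:
  assumes D: "distributed M lborel Y (normal_density 0 \<sigma>)" and \<sigma>: "\<sigma> > 0"
  shows "integrable M (\<lambda>\<omega>. Y \<omega> ^ k)" and "expectation (\<lambda>\<omega>. (Y \<omega>)\<^sup>2) = \<sigma>\<^sup>2"
    and "expectation (\<lambda>\<omega>. Y \<omega> ^ 4) = 3 * \<sigma> ^ 4"
proof -
  show "integrable M (\<lambda>\<omega>. Y \<omega> ^ k)"
    using distributed_integrable[OF D, of "\<lambda>x. x ^ k"] integrable_normal_moment[OF \<sigma>, of 0 k] by simp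
  show "expectation (\<lambda>\<omega>. (Y \<omega>)\<^sup>2) = \<sigma>\<^sup>2"
    using distributed_integral[OF D, of "\<lambda>x. x\<^sup>2"] integral_normal_moment_even[OF \<sigma>, of 0 1]
    by (simp add: fact_numeral)
  show "expectation (\<lambda>\<omega>. Y \<omega> ^ 4) = 3 * \<sigma> ^ 4"
    using distributed_integral[OF D, of "\<lambda>x. x ^ 4"] integral_normal_moment_even[OF \<sigma>, of 0 2]
    by (simp add: fact_numeral power_divide flip: power_mult)
qed

lemma (in prob_space) independent_increments_indep_var:
  assumes adm: "admissible_filtration M F X" and st: "0 \<le> s" "s < t"
    and S: "S \<in> borel_measurable (F s)" and X: "X s \<in> borel_measurable M" "X t \<in> borel_measurable M"
  shows "indep_var borel S borel (\<lambda>\<omega>. X t \<omega> - X s \<omega>)"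
proof -
  have F: "space (F s) = space M" "sets (F s) \<subseteq> events"
    using adm by (auto simp: admissible_filtration_def subalgebra_def)
  have SM: "S \<in> borel_measurable M"
    using measurable_mono[OF order_refl refl F(2) F(1), of borel] S by blast
  \<comment> \<open>Independence is known for the preimage sets, while \<open>indep_var\<close>
    speaks of the generated sigma-algebras. Stability under intersection bridges the gap.\<close>
  have stable: "Int_stable {Z -` A \<inter> space M | A. A \<in> sets borel}" for Z :: "'a \<Rightarrow> real"
  proof (rule Int_stableI, safe)
    fix A B :: "real set" assume "A \<in> sets borel" "B \<in> sets borel"
    then show "\<exists>C. (Z -` A \<inter> space M) \<inter> (Z -` B \<inter> space M) = Z -` C \<inter> space M \<and> C \<in> sets borel"
      by (intro exI[of _ "A \<inter> B"]) auto
  qed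
  have "indep_set (sets (F s)) {(\<lambda>\<omega>. X t \<omega> - X s \<omega>) -` B \<inter> space M | B. B \<in> sets borel}"
    using adm st by (auto simp: admissible_filtration_def independent_increments_def)
  moreover have "{S -` A \<inter> space M | A. A \<in> sets borel} \<subseteq> sets (F s)"
    using measurable_sets[OF S] F by auto
  ultimately have "indep_set {S -` A \<inter> space M | A. A \<in> sets borel}
      {(\<lambda>\<omega>. X t \<omega> - X s \<omega>) -` B \<inter> space M | B. B \<in> sets borel}"
    unfolding indep_sets2_eq by blast
  then show ?thesis
    unfolding indep_var_eq using SM X
    by (auto intro!: indep_set_sigma_sets stable)
qed

text \<open>The centred squared increments are orthogonal martingale differences, so their variances add.\<close>

lemma (in prob_space) centred_squared_increments_moment:
  fixes X :: "real \<Rightarrow> 'a \<Rightarrow> real" and s :: "nat \<Rightarrow> real"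
  assumes adm: "admissible_filtration M F X"
    and mom: "\<And>r t. 0 \<le> r \<Longrightarrow> r < t \<Longrightarrow>
      integrable M (\<lambda>\<omega>. (X t \<omega> - X r \<omega>) ^ 2) \<and> integrable M (\<lambda>\<omega>. (X t \<omega> - X r \<omega>) ^ 4) \<and>
      expectation (\<lambda>\<omega>. (X t \<omega> - X r \<omega>)\<^sup>2) = q * (t - r) \<and>
      expectation (\<lambda>\<omega>. (X t \<omega> - X r \<omega>) ^ 4) = 3 * (q * (t - r))\<^sup>2"
    and s: "0 \<le> s 0" "\<And>i. i < n \<Longrightarrow> s i \<le> s (Suc i)"
  defines "Q m \<omega> \<equiv> \<Sum>i<m. (X (s (Suc i)) \<omega> - X (s i) \<omega>)\<^sup>2 - q * (s (Suc i) - s i)"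
  shows "0 \<le> s n \<and> Q n \<in> borel_measurable (F (s n)) \<and> integrable M (\<lambda>\<omega>. (Q n \<omega>)\<^sup>2) \<and>
    expectation (\<lambda>\<omega>. (Q n \<omega>)\<^sup>2) = (\<Sum>i<n. 2 * q\<^sup>2 * (s (Suc i) - s i)\<^sup>2)"
  using s(2)
proof (induction n)
  case 0
  then show ?case using s(1) by (simp add: Q_def)
next
  case (Suc n)
  have F: "space (F t) = space M" "sets (F t) \<subseteq> events" for t
    using adm by (auto simp: admissible_filtration_def subalgebra_def)
  have F_mono: "sets (F r) \<subseteq> sets (F t)" if "r \<le> t" for r t
    using filtration.sets_F_mono[of "space M" F r t] adm that by (simp add: admissible_filtration_def)
  have lift: "Z \<in> borel_measurable (F t)" if "Z \<in> borel_measurable (F r)" "r \<le> t" for r t and Z :: "'a \<Rightarrow> real"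
    using measurable_mono[OF order_refl refl F_mono[OF that(2)], of borel] that(1) F(1) by auto
  have lift_M: "Z \<in> borel_measurable M" if "Z \<in> borel_measurable (F r)" for r and Z :: "'a \<Rightarrow> real"
    using measurable_mono[OF order_refl refl F(2)[of r] F(1)[of r]] that by blast
  have X: "X t \<in> borel_measurable (F t)" if "0 \<le> t" for t
    using adm that by (auto simp: admissible_filtration_def independent_increments_def)
  let ?r = "s n" and ?t = "s (Suc n)"
  define D where "D \<omega> = X ?t \<omega> - X ?r \<omega>" for \<omega>
  define Y where "Y \<omega> = (D \<omega>)\<^sup>2 - q * (?t - ?r)" for \<omega>
  have IH: "0 \<le> ?r" "Q n \<in> borel_measurable (F ?r)" "integrable M (\<lambda>\<omega>. (Q n \<omega>)\<^sup>2)"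
    "expectation (\<lambda>\<omega>. (Q n \<omega>)\<^sup>2) = (\<Sum>i<n. 2 * q\<^sup>2 * (s (Suc i) - s i)\<^sup>2)"
    using Suc.IH Suc.prems by (simp_all only: less_SucI)
  have rt: "?r \<le> ?t" using Suc.prems by simp
  have t0: "0 \<le> ?t" using IH(1) rt by linarith
  have QS: "Q (Suc n) = (\<lambda>\<omega>. Q n \<omega> + Y \<omega>)"
    by (simp add: Q_def Y_def D_def fun_eq_iff)
  have Dm: "D \<in> borel_measurable (F ?t)"
    unfolding D_def[abs_def] using lift[OF X[OF IH(1)] rt] X[OF t0] by (rule borel_measurable_diff[rotated])
  then have Ym: "Y \<in> borel_measurable (F ?t)"
    unfolding Y_def[abs_def] by (intro borel_measurable_diff borel_measurable_power) auto
  have QSm: "Q (Suc n) \<in> borel_measurable (F ?t)"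
    unfolding QS by (intro borel_measurable_add lift[OF IH(2) rt] Ym)
  note QM = lift_M[OF IH(2)] and YM = lift_M[OF Ym] and DM = lift_M[OF Dm]
  have "integrable M (\<lambda>\<omega>. (Q (Suc n) \<omega>)\<^sup>2) \<and>
    expectation (\<lambda>\<omega>. (Q (Suc n) \<omega>)\<^sup>2) =
    expectation (\<lambda>\<omega>. (Q n \<omega>)\<^sup>2) + 2 * q\<^sup>2 * (?t - ?r)\<^sup>2"
  \<comment> \<open>Partitions may repeat points, but the moment hypothesis covers only intervals of
    positive length; a repeated point adds nothing.\<close>
  proof (cases "?r = ?t")
    case True
    then have "Q (Suc n) = Q n"
      by (simp add: QS Y_def D_def)
    then show ?thesis using IH True by simp
  next
    case False
    then have less: "?r < ?t" using rt by simp
    have D2: "integrable M (\<lambda>\<omega>. (D \<omega>)\<^sup>2)" "expectation (\<lambda>\<omega>. (D \<omega>)\<^sup>2) = q * (?t - ?r)"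
      and D4: "integrable M (\<lambda>\<omega>. D \<omega> ^ 4)" "expectation (\<lambda>\<omega>. D \<omega> ^ 4) = 3 * (q * (?t - ?r))\<^sup>2"
      using mom[OF IH(1) less] by (simp_all add: D_def)
    have Y2_eq: "(\<lambda>\<omega>. (Y \<omega>)\<^sup>2) = (\<lambda>\<omega>. D \<omega> ^ 4 - 2 * (q * (?t - ?r)) * (D \<omega>)\<^sup>2 + (q * (?t - ?r))\<^sup>2)"
      by (auto simp: Y_def power2_diff simp flip: power_mult)
    \<comment> \<open>With v = q(t - r), the variance of the squared Gaussian increment is 3v^2 -
      2v^2 + v^2 = 2v^2.\<close>
    have Y2: "integrable M (\<lambda>\<omega>. (Y \<omega>)\<^sup>2)" "expectation (\<lambda>\<omega>. (Y \<omega>)\<^sup>2) = 2 * q\<^sup>2 * (?t - ?r)\<^sup>2"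
      unfolding Y2_eq using D2 D4 by (simp_all add: prob_space) (simp add: power2_eq_square algebra_simps)
    have Y1: "integrable M Y" "expectation Y = 0"
      unfolding Y_def[abs_def] using D2 by (auto simp: prob_space)
    have Qi: "integrable M (Q n)"
      by (rule square_integrable_imp_integrable[OF QM IH(3)])
    have "indep_var borel (Q n) borel (\<lambda>\<omega>. X ?t \<omega> - X ?r \<omega>)"
      using IH less t0 by (intro independent_increments_indep_var[OF adm] lift_M[OF X]) auto
    from indep_var_compose[OF this, of "\<lambda>x. x" borel "\<lambda>x. x\<^sup>2 - q * (?t - ?r)" borel]
    have ind: "indep_var borel (Q n) borel Y"
      by (simp add: o_def Y_def[abs_def] D_def)
    \<comment> \<open>The cross term vanishes: \<open>Q n\<close> depends on the past only, and
      \<open>Y\<close> is centred and independent of it.\<close>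
    have QY: "integrable M (\<lambda>\<omega>. Q n \<omega> * Y \<omega>)" "expectation (\<lambda>\<omega>. Q n \<omega> * Y \<omega>) = 0"
      using indep_var_integrable[OF ind Qi Y1(1)] indep_var_lebesgue_integral[OF ind Qi Y1(1)] Y1(2)
      by auto
    have "(\<lambda>\<omega>. (Q (Suc n) \<omega>)\<^sup>2) = (\<lambda>\<omega>. (Q n \<omega>)\<^sup>2 + 2 * (Q n \<omega> * Y \<omega>) + (Y \<omega>)\<^sup>2)"
      by (auto simp: QS power2_eq_square algebra_simps)
    then show ?thesis
      using IH(3) Y2 QY by simp
  qed
  then show ?case
    using QSm t0 IH by simp
qed

text \<open>Almost surely the increment is a sum of independent normals coming from \<open>W\<close>
  and \<open>V\<close>, so it is normal and the variances add to q(t - s). The fourth moment is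
  three times the squared variance.\<close>

lemma (in prob_space) observation_increment_moments:
  assumes model: "circular_filtering_model M k\<^sub>\<phi> k\<^sub>u W V \<phi> U" and k: "k\<^sub>\<phi> > 0" "k\<^sub>u > 0"
    and st: "0 \<le> s" "s < t"
  defines "q \<equiv> 1 / k\<^sub>\<phi> + 1 / k\<^sub>u"
  shows "integrable M (\<lambda>\<omega>. (U t \<omega> - U s \<omega>) ^ n)"
    and "expectation (\<lambda>\<omega>. (U t \<omega> - U s \<omega>)\<^sup>2) = q * (t - s)"
    and "expectation (\<lambda>\<omega>. (U t \<omega> - U s \<omega>) ^ 4) = 3 * (q * (t - s))\<^sup>2"
proof -
  have BW: "brownian_motion M W" and BV: "brownian_motion M V" and WV: "independent_processes M W V"
    and U_meas: "\<forall>t\<ge>0. U t \<in> borel_measurable M"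
    and \<phi>_eq: "AE \<omega> in M. \<forall>t\<ge>0. \<phi> t \<omega> = \<phi> 0 \<omega> + 1 / sqrt k\<^sub>\<phi> * W t \<omega>"
    and U_eq: "AE \<omega> in M. \<forall>t\<ge>0. U t \<omega> = U 0 \<omega> + (\<phi> t \<omega> - \<phi> 0 \<omega>) + 1 / sqrt k\<^sub>u * V t \<omega>"
    using model unfolding circular_filtering_model_def by blast+
  have BM_meas: "B r \<in> borel_measurable M" if "brownian_motion M B" "0 \<le> r" for B r
    using that unfolding brownian_motion_def by blast
  have BM_dist: "distributed M lborel (\<lambda>\<omega>. B t \<omega> - B s \<omega>) (normal_density 0 (sqrt (t - s)))"
    if "brownian_motion M B" for B
    using that st unfolding brownian_motion_def by blast
  have t0: "0 \<le> t" using st by simp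
  define a b where "a = 1 / sqrt k\<^sub>\<phi>" and "b = 1 / sqrt k\<^sub>u"
  have a: "a > 0" "a\<^sup>2 = 1 / k\<^sub>\<phi>" and b: "b > 0" "b\<^sup>2 = 1 / k\<^sub>u"
    using k by (auto simp: a_def b_def power_divide)
  define A B where "A \<omega> = W t \<omega> - W s \<omega>" and "B \<omega> = V t \<omega> - V s \<omega>" for \<omega>
  define \<sigma> where "\<sigma> = sqrt (q * (t - s))"
  have q: "q > 0" using k by (simp add: q_def add_pos_pos)
  have \<sigma>: "\<sigma> > 0" "\<sigma>\<^sup>2 = q * (t - s)"
    using q st by (auto simp: \<sigma>_def)
  have "indep_var borel A borel B"
    unfolding A_def[abs_def] B_def[abs_def]
    by (intro indep_increments_of_independent_processes[OF WV] BM_meas[OF BW] BM_meas[OF BV] st t0)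
  from indep_var_compose[OF this, of "\<lambda>x. a * x" borel "\<lambda>x. b * x" borel]
  have ind: "indep_var borel (\<lambda>\<omega>. a * A \<omega>) borel (\<lambda>\<omega>. b * B \<omega>)"
    by (simp add: o_def)
  have "distributed M lborel A (normal_density 0 (sqrt (t - s)))"
    "distributed M lborel B (normal_density 0 (sqrt (t - s)))"
    unfolding A_def[abs_def] B_def[abs_def] by (intro BM_dist BW BV)+
  then have "distributed M lborel (\<lambda>\<omega>. a * A \<omega>) (normal_density 0 (a * sqrt (t - s)))"
    "distributed M lborel (\<lambda>\<omega>. b * B \<omega>) (normal_density 0 (b * sqrt (t - s)))"
    using normal_density_affine[of A 0 "sqrt (t - s)" a 0] normal_density_affine[of B 0 "sqrt (t - s)" b 0]
      a b st by simp_all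
  then have "distributed M lborel (\<lambda>\<omega>. a * A \<omega> + b * B \<omega>)
      (normal_density (0 + 0) (sqrt ((a * sqrt (t - s))\<^sup>2 + (b * sqrt (t - s))\<^sup>2)))"
    using a b st by (intro add_indep_normal[OF ind]) auto
  also have "sqrt ((a * sqrt (t - s))\<^sup>2 + (b * sqrt (t - s))\<^sup>2) = \<sigma>"
    using a b st by (simp add: \<sigma>_def q_def power_mult_distrib distrib_right)
  finally have D: "distributed M lborel (\<lambda>\<omega>. a * A \<omega> + b * B \<omega>) (normal_density 0 \<sigma>)"
    by simp
  have U: "U t \<in> borel_measurable M" "U s \<in> borel_measurable M"
    using U_meas st(1) t0 by blast+
  have AB: "(\<lambda>\<omega>. a * A \<omega> + b * B \<omega>) \<in> borel_measurable M"
    using distributed_measurable[OF D] by simp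
  have eq: "AE \<omega> in M. U t \<omega> - U s \<omega> = a * A \<omega> + b * B \<omega>"
  proof -
    from \<phi>_eq U_eq show ?thesis
    proof eventually_elim
      case (elim \<omega>)
      have "\<phi> t \<omega> = \<phi> 0 \<omega> + a * W t \<omega>" "\<phi> s \<omega> = \<phi> 0 \<omega> + a * W s \<omega>"
        "U t \<omega> = U 0 \<omega> + (\<phi> t \<omega> - \<phi> 0 \<omega>) + b * V t \<omega>"
        "U s \<omega> = U 0 \<omega> + (\<phi> s \<omega> - \<phi> 0 \<omega>) + b * V s \<omega>"
        using elim st(1) t0 unfolding a_def b_def by blast+
      then show ?case
        by (simp add: A_def B_def algebra_simps)
    qed
  qed
  have eqn: "AE \<omega> in M. (U t \<omega> - U s \<omega>) ^ m = (a * A \<omega> + b * B \<omega>) ^ m" for m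
    using eq by eventually_elim simp
  have meas: "(\<lambda>\<omega>. (U t \<omega> - U s \<omega>) ^ m) \<in> borel_measurable M"
    "(\<lambda>\<omega>. (a * A \<omega> + b * B \<omega>) ^ m) \<in> borel_measurable M" for m
    by (intro borel_measurable_power borel_measurable_diff U AB)+
  show "integrable M (\<lambda>\<omega>. (U t \<omega> - U s \<omega>) ^ n)"
    using integrable_cong_AE[OF meas eqn] distributed_normal_moments(1)[OF D \<sigma>(1)] by blast
  show "expectation (\<lambda>\<omega>. (U t \<omega> - U s \<omega>)\<^sup>2) = q * (t - s)"
    using integral_cong_AE[OF meas eqn, of 2] distributed_normal_moments(2)[OF D \<sigma>(1)] \<sigma>(2) by simp
  have "\<sigma> ^ 4 = (\<sigma>\<^sup>2)\<^sup>2" by (simp flip: power_mult)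
  then show "expectation (\<lambda>\<omega>. (U t \<omega> - U s \<omega>) ^ 4) = 3 * (q * (t - s))\<^sup>2"
    using integral_cong_AE[OF meas eqn, of 4] distributed_normal_moments(3)[OF D \<sigma>(1)] \<sigma>(2) by simp
qed

section \<open>Convergence of squared increments along partitions\<close>

lemma partition_sequence_nonneg:
  assumes "partition_sequence t N s" "i \<le> N k"
  shows "0 \<le> s k i"
  using assms(2)
proof (induction i)
  case 0
  then show ?case using assms(1) by (simp add: partition_sequence_def)
next
  case (Suc i)
  then have "s k i \<le> s k (Suc i)"
    using assms(1) by (simp add: partition_sequence_def)
  with Suc show ?case by simp
qed

lemma (in prob_space) squared_increments_converge:
  fixes X :: "real \<Rightarrow> 'a \<Rightarrow> real"
  assumes adm: "admissible_filtration M F X" and X: "\<And>t. 0 \<le> t \<Longrightarrow> X t \<in> borel_measurable M"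
    and mom: "\<And>r t. 0 \<le> r \<Longrightarrow> r < t \<Longrightarrow>
      integrable M (\<lambda>\<omega>. (X t \<omega> - X r \<omega>) ^ 2) \<and> integrable M (\<lambda>\<omega>. (X t \<omega> - X r \<omega>) ^ 4) \<and>
      expectation (\<lambda>\<omega>. (X t \<omega> - X r \<omega>)\<^sup>2) = q * (t - r) \<and>
      expectation (\<lambda>\<omega>. (X t \<omega> - X r \<omega>) ^ 4) = 3 * (q * (t - r))\<^sup>2"
    and part: "partition_sequence t N s" and t: "0 \<le> t"
  shows "converges_in_probability M
    (\<lambda>k \<omega>. \<Sum>i<N k. (X (s k (Suc i)) \<omega> - X (s k i) \<omega>)\<^sup>2) (\<lambda>\<omega>. q * t)"
  unfolding converges_in_probability_def
proof (intro conjI allI impI)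
  let ?S = "\<lambda>k \<omega>. \<Sum>i<N k. (X (s k (Suc i)) \<omega> - X (s k i) \<omega>)\<^sup>2"
  show S_meas: "?S k \<in> borel_measurable M" for k
    by (intro borel_measurable_sum borel_measurable_power borel_measurable_diff X
        partition_sequence_nonneg[OF part]) auto
  show "(\<lambda>\<omega>. q * t) \<in> borel_measurable M" by simp
  have s0: "s k 0 = 0" and sN: "s k (N k) = t" and mono: "i < N k \<Longrightarrow> s k i \<le> s k (Suc i)" for k i
    using part by (auto simp: partition_sequence_def)
  have total: "(\<Sum>i<N k. s k (Suc i) - s k i) = t" for k
    using sum_lessThan_telescope[of "s k" "N k"] s0 sN by simp
  have centred: "?S k \<omega> - q * t =
      (\<Sum>i<N k. (X (s k (Suc i)) \<omega> - X (s k i) \<omega>)\<^sup>2 - q * (s k (Suc i) - s k i))" for k \<omega>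
    by (subst sum_subtractf) (simp only: sum_distrib_left[symmetric] total)
  have L2: "integrable M (\<lambda>\<omega>. (?S k \<omega> - q * t)\<^sup>2)"
    "expectation (\<lambda>\<omega>. (?S k \<omega> - q * t)\<^sup>2) = (\<Sum>i<N k. 2 * q\<^sup>2 * (s k (Suc i) - s k i)\<^sup>2)" for k
    unfolding centred
    using centred_squared_increments_moment[OF adm mom, of "s k" "N k"] s0 mono by auto
  fix \<epsilon> :: real assume \<epsilon>: "\<epsilon> > 0"
  let ?p = "\<lambda>k. prob {\<omega> \<in> space M. \<bar>?S k \<omega> - q * t\<bar> > \<epsilon>}"
  have bound: "?p k \<le> 2 * q\<^sup>2 * \<delta> * t / \<epsilon>\<^sup>2" if \<delta>: "\<And>i. i < N k \<Longrightarrow> s k (Suc i) - s k i < \<delta>" for k \<delta>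
  proof -
    \<comment> \<open>Convergence in probability uses a strict inequality, Chebyshev's bound a weak
      one.\<close>
    have "?p k \<le> prob {\<omega> \<in> space M. \<bar>?S k \<omega> - q * t\<bar> \<ge> \<epsilon>}"
      using S_meas[of k] by (intro finite_measure_mono) auto
    also have "\<dots> \<le> (\<Sum>i<N k. 2 * q\<^sup>2 * (s k (Suc i) - s k i)\<^sup>2) / \<epsilon>\<^sup>2"
      using second_moment_method[of "\<lambda>\<omega>. ?S k \<omega> - q * t" \<epsilon>] S_meas[of k] L2[of k] \<epsilon> by simp
    \<comment> \<open>One factor of each squared length is bounded by the mesh; the other telescopes
      to t.\<close>
    also have "\<dots> \<le> (\<Sum>i<N k. 2 * q\<^sup>2 * \<delta> * (s k (Suc i) - s k i)) / \<epsilon>\<^sup>2"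
    proof (intro divide_right_mono sum_mono)
      fix i assume "i \<in> {..<N k}"
      then have "(s k (Suc i) - s k i)\<^sup>2 \<le> \<delta> * (s k (Suc i) - s k i)"
        unfolding power2_eq_square using \<delta>[of i] mono[of i k] by (intro mult_right_mono) auto
      then show "2 * q\<^sup>2 * (s k (Suc i) - s k i)\<^sup>2 \<le> 2 * q\<^sup>2 * \<delta> * (s k (Suc i) - s k i)"
        using mult_left_mono[of _ _ "2 * q\<^sup>2"] by (simp add: mult.assoc)
    qed simp
    also have "\<dots> = 2 * q\<^sup>2 * \<delta> * t / \<epsilon>\<^sup>2"
      unfolding sum_distrib_left[symmetric] total ..
    finally show ?thesis .
  qed
  show "?p \<longlonglongrightarrow> 0"
  proof (rule order_tendstoI)
    fix \<eta> :: real assume "\<eta> > 0"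
    \<comment> \<open>Chosen to push the bound below \<eta>; the added 1 keeps the denominator
      positive when t = 0.\<close>
    define \<delta> where "\<delta> = \<eta> * \<epsilon>\<^sup>2 / (2 * q\<^sup>2 * t + 1)"
    have pos: "2 * q\<^sup>2 * t + 1 > 0"
      using t by (intro add_nonneg_pos) auto
    then have "\<delta> > 0"
      using \<open>\<eta> > 0\<close> \<epsilon> by (simp add: \<delta>_def)
    have "2 * q\<^sup>2 * \<delta> * t / \<epsilon>\<^sup>2 = \<eta> * (2 * q\<^sup>2 * t / (2 * q\<^sup>2 * t + 1))"
      using \<epsilon> by (simp add: \<delta>_def)
    also have "\<dots> < \<eta> * 1"
      using \<open>\<eta> > 0\<close> pos by (intro mult_strict_left_mono) auto
    finally have small: "2 * q\<^sup>2 * \<delta> * t / \<epsilon>\<^sup>2 < \<eta>" by simp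
    have "\<forall>\<^sub>F k in sequentially. \<forall>i<N k. s k (Suc i) - s k i < \<delta>"
      using part \<open>\<delta> > 0\<close> by (simp add: partition_sequence_def)
    then show "\<forall>\<^sub>F k in sequentially. ?p k < \<eta>"
    proof eventually_elim
      case (elim k)
      then show ?case using bound[of k \<delta>] small by fastforce
    qed
  next
    fix \<eta> :: real assume "\<eta> < 0"
    then show "\<forall>\<^sub>F k in sequentially. \<eta> < ?p k"
      by (intro always_eventually allI) (meson less_le_trans measure_nonneg)
  qed
qed

text \<open>No value lies within a third of |a - b| of both constants, so the two deviation events
  cover the space and their probabilities cannot both tend to zero.\<close>

lemma (in prob_space) converges_in_probability_const_unique:
  assumes "converges_in_probability M Y (\<lambda>\<omega>. a)" "converges_in_probability M Y (\<lambda>\<omega>. b)"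
  shows "a = b"
proof (rule ccontr)
  assume "a \<noteq> b"
  define \<epsilon> where "\<epsilon> = \<bar>a - b\<bar> / 3"
  have \<epsilon>: "\<epsilon> > 0" using \<open>a \<noteq> b\<close> by (simp add: \<epsilon>_def)
  let ?A = "\<lambda>c k. {\<omega> \<in> space M. \<bar>Y k \<omega> - c\<bar> > \<epsilon>}"
  have Y: "Y k \<in> borel_measurable M" for k
    using assms(1) by (simp add: converges_in_probability_def)
  have ev: "?A c k \<in> events" for c k
    using Y[of k] by measurable
  have "1 \<le> prob (?A a k) + prob (?A b k)" for k
  proof -
    have "space M \<subseteq> ?A a k \<union> ?A b k"
    proof
      fix \<omega> assume "\<omega> \<in> space M"
      moreover have "\<bar>a - b\<bar> \<le> \<bar>Y k \<omega> - a\<bar> + \<bar>Y k \<omega> - b\<bar>" by linarith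
      then have "\<bar>Y k \<omega> - a\<bar> > \<epsilon> \<or> \<bar>Y k \<omega> - b\<bar> > \<epsilon>"
        using \<epsilon> unfolding \<epsilon>_def by argo
      ultimately show "\<omega> \<in> ?A a k \<union> ?A b k" by blast
    qed
    then have "?A a k \<union> ?A b k = space M" by auto
    then show ?thesis
      using measure_Un_le[OF ev[of k a] ev[of k b]] prob_space by simp
  qed
  moreover have "(\<lambda>k. prob (?A a k) + prob (?A b k)) \<longlonglongrightarrow> 0 + 0"
    using assms \<epsilon> by (intro tendsto_add) (auto simp: converges_in_probability_def)
  ultimately have "(1::real) \<le> 0 + 0"
    by (intro LIMSEQ_le_const) auto
  then show False by simp
qed

text \<open>A concrete partition sequence, without which uniqueness of the quadratic variation rate
  could hold no content; k + 1 intervals avoid division by zero at k = 0.\<close>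

lemma partition_sequence_uniform: "partition_sequence 1 Suc (\<lambda>k i. real i / real (Suc k))"
  unfolding partition_sequence_def
proof (intro conjI allI impI)
  fix \<delta> :: real assume "\<delta> > 0"
  have "(\<lambda>k. 1 / real (Suc k)) \<longlonglongrightarrow> 0"
    using LIMSEQ_inverse_real_of_nat by (simp add: inverse_eq_divide)
  then have "\<forall>\<^sub>F k in sequentially. 1 / real (Suc k) < \<delta>"
    using \<open>\<delta> > 0\<close> by (rule order_tendstoD)
  then show "\<forall>\<^sub>F k in sequentially. \<forall>i<Suc k. real (Suc i) / real (Suc k) - real i / real (Suc k) < \<delta>"
    by eventually_elim (simp add: diff_divide_distrib[symmetric])
qed (auto intro!: divide_right_mono)

lemma (in prob_space) quadratic_variation_rate_observations:
  assumes model: "circular_filtering_model M k\<^sub>\<phi> k\<^sub>u W V \<phi> U" and k: "k\<^sub>\<phi> > 0" "k\<^sub>u > 0"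
    and adm: "admissible_filtration M F U"
  shows "quadratic_variation_rate M U = 1 / k\<^sub>\<phi> + 1 / k\<^sub>u"
  unfolding quadratic_variation_rate_def
proof (rule the_equality)
  show conv: "\<forall>t\<ge>0. \<forall>N s. partition_sequence t N s \<longrightarrow> converges_in_probability M
      (\<lambda>k \<omega>. \<Sum>i<N k. (U (s k (Suc i)) \<omega> - U (s k i) \<omega>)\<^sup>2) (\<lambda>\<omega>. (1 / k\<^sub>\<phi> + 1 / k\<^sub>u) * t)"
  proof (intro allI impI)
    fix t :: real and N s assume "t \<ge> 0" "partition_sequence t N s"
    then show "converges_in_probability M
        (\<lambda>k \<omega>. \<Sum>i<N k. (U (s k (Suc i)) \<omega> - U (s k i) \<omega>)\<^sup>2) (\<lambda>\<omega>. (1 / k\<^sub>\<phi> + 1 / k\<^sub>u) * t)"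
      using model observation_increment_moments[OF model k]
      by (intro squared_increments_converge[OF adm]) (auto simp: circular_filtering_model_def)
  qed
  fix q assume "\<forall>t\<ge>0. \<forall>N s. partition_sequence t N s \<longrightarrow> converges_in_probability M
      (\<lambda>k \<omega>. \<Sum>i<N k. (U (s k (Suc i)) \<omega> - U (s k i) \<omega>)\<^sup>2) (\<lambda>\<omega>. q * t)"
  \<comment> \<open>Comparing the two limits at time 1 identifies the rates themselves.\<close>
  with conv partition_sequence_uniform have "q * 1 = (1 / k\<^sub>\<phi> + 1 / k\<^sub>u) * 1"
    by (intro converges_in_probability_const_unique) (blast intro: zero_le_one)+
  then show "q = 1 / k\<^sub>\<phi> + 1 / k\<^sub>u" by simp
qed

section \<open>Stochastic integrals and solutions\<close>

lemma converges_in_probability_cong: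
  assumes "\<And>k \<omega>. \<omega> \<in> space M \<Longrightarrow> Y k \<omega> = Y' k \<omega>"
  shows "converges_in_probability M Y L \<longleftrightarrow> converges_in_probability M Y' L"
proof -
  have "Y k \<in> borel_measurable M \<longleftrightarrow> Y' k \<in> borel_measurable M" for k
    by (rule measurable_cong) (rule assms)
  moreover have "{\<omega> \<in> space M. \<bar>Y k \<omega> - L \<omega>\<bar> > \<epsilon>} = {\<omega> \<in> space M. \<bar>Y' k \<omega> - L \<omega>\<bar> > \<epsilon>}" for k \<epsilon>
    using assms by auto
  ultimately show ?thesis
    by (simp only: converges_in_probability_def)
qed

lemma stratonovich_integral_cong:
  assumes "\<And>t \<omega>. 0 \<le> t \<Longrightarrow> \<omega> \<in> space M \<Longrightarrow> H t \<omega> = H' t \<omega>"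
  shows "stratonovich_integral M H X J \<longleftrightarrow> stratonovich_integral M H' X J"
proof -
  have "converges_in_probability M (\<lambda>k \<omega>. \<Sum>i<N k. (H (s k i) \<omega> + H (s k (Suc i)) \<omega>) / 2 *
          (X (s k (Suc i)) \<omega> - X (s k i) \<omega>)) (J t) \<longleftrightarrow>
        converges_in_probability M (\<lambda>k \<omega>. \<Sum>i<N k. (H' (s k i) \<omega> + H' (s k (Suc i)) \<omega>) / 2 *
          (X (s k (Suc i)) \<omega> - X (s k i) \<omega>)) (J t)"
    if "partition_sequence t N s" for t N s
    using partition_sequence_nonneg[OF that]
    by (intro converges_in_probability_cong sum.cong refl) (simp add: assms)
  then show ?thesis
    unfolding stratonovich_integral_def by blast
qed

lemma stratonovich_integral_const_eq_ito_integral: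
  "stratonovich_integral M (\<lambda>t \<omega>. c) X J \<longleftrightarrow> ito_integral M (\<lambda>t \<omega>. c) X J"
  by (simp add: stratonovich_integral_def ito_integral_def)

text \<open>Vector fields are known to agree only on \<Theta>, but solutions stay there by
  definition. Allowing two notions of integral lets the same lemma serve for replacing the fields
  and for passing from Stratonovich to Ito.\<close>

lemma sde_solution_cong:
  fixes \<theta> :: "real \<Rightarrow> 'a \<Rightarrow> real ^ 'm"
  assumes b: "\<And>\<eta>. \<eta> \<in> \<Theta> \<Longrightarrow> b \<eta> = b' \<eta>"
    and \<sigma>: "\<And>j J. (\<And>t \<omega>. 0 \<le> t \<Longrightarrow> \<omega> \<in> space M \<Longrightarrow> \<theta> t \<omega> \<in> \<Theta>) \<Longrightarrow>
      I M (\<lambda>t \<omega>. \<sigma> (\<theta> t \<omega>) $ j) X J \<longleftrightarrow> I' M (\<lambda>t \<omega>. \<sigma>' (\<theta> t \<omega>) $ j) X J"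
  shows "sde_solution I M F X \<Theta> b \<sigma> \<theta> \<longleftrightarrow> sde_solution I' M F X \<Theta> b' \<sigma>' \<theta>"
\<comment> \<open>If the process leaves \<Theta>, neither side is a solution.\<close>
proof (cases "\<forall>t\<ge>0. \<forall>\<omega>\<in>space M. \<theta> t \<omega> \<in> \<Theta>")
  case True
  have drift: "(AE \<omega> in M. ((\<lambda>s. b (\<theta> s \<omega>) $ j) has_integral (\<theta> t \<omega> $ j - \<theta> 0 \<omega> $ j - J t \<omega>)) {0..t}) \<longleftrightarrow>
      (AE \<omega> in M. ((\<lambda>s. b' (\<theta> s \<omega>) $ j) has_integral (\<theta> t \<omega> $ j - \<theta> 0 \<omega> $ j - J t \<omega>)) {0..t})"
    for j t and J :: "real \<Rightarrow> 'a \<Rightarrow> real"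
    using True by (intro AE_cong has_integral_cong) (auto simp: b)
  have diffusion: "I M (\<lambda>t \<omega>. \<sigma> (\<theta> t \<omega>) $ j) X J \<longleftrightarrow> I' M (\<lambda>t \<omega>. \<sigma>' (\<theta> t \<omega>) $ j) X J" for j J
    using True by (intro \<sigma>) auto
  show ?thesis
    unfolding sde_solution_def drift diffusion ..
qed (auto simp: sde_solution_def)

theorem mainTheorem3:
  fixes M :: "'a measure" and F :: "real \<Rightarrow> 'a measure"
    and W V \<phi> U :: "real \<Rightarrow> 'a \<Rightarrow> real" and k\<^sub>\<phi> k\<^sub>u :: real
  assumes "prob_space M" and "k\<^sub>\<phi> > 0" and "k\<^sub>u > 0"
    and "circular_filtering_model M k\<^sub>\<phi> k\<^sub>u W V \<phi> U"
    and "admissible_filtration M F U"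
  defines "b \<equiv> \<lambda>\<theta> :: real ^ 2. vector [0, - 1 / (2 * (k\<^sub>\<phi> + k\<^sub>u)) * precision_decay (\<theta> $ 2)] :: real ^ 2"
    and "\<sigma> \<equiv> \<lambda>\<theta> :: real ^ 2. vector [k\<^sub>u / (k\<^sub>\<phi> + k\<^sub>u), 0] :: real ^ 2"
  shows "(\<forall>\<theta>\<in>von_mises_domain.
            projected_field von_mises (A_dagger M U k\<^sub>\<phi> k\<^sub>u) \<theta> = b \<theta> \<and>
            projected_field von_mises (B_dagger k\<^sub>\<phi> k\<^sub>u) \<theta> = \<sigma> \<theta>)
       \<and> (\<forall>\<theta>. projection_filter M F U k\<^sub>\<phi> k\<^sub>u von_mises_domain von_mises \<theta> \<longleftrightarrow>
                sde_solution stratonovich_integral M F U von_mises_domain b \<sigma> \<theta>)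
       \<and> (\<forall>\<theta>. projection_filter M F U k\<^sub>\<phi> k\<^sub>u von_mises_domain von_mises \<theta> \<longleftrightarrow>
                sde_solution ito_integral M F U von_mises_domain b \<sigma> \<theta>)"
proof -
  interpret prob_space M by fact
  have q: "quadratic_variation_rate M U = 1 / k\<^sub>\<phi> + 1 / k\<^sub>u"
    by (rule quadratic_variation_rate_observations) fact+
  have A: "projected_field von_mises (A_dagger M U k\<^sub>\<phi> k\<^sub>u) \<theta> = b \<theta>"
    and B: "projected_field von_mises (B_dagger k\<^sub>\<phi> k\<^sub>u) \<theta> = \<sigma> \<theta>" if "\<theta> \<in> von_mises_domain" for \<theta>
    using that projected_field_von_mises_A_dagger[OF _ assms(2,3) q]
      projected_field_von_mises_B_dagger
    by (auto simp: von_mises_domain_def b_def \<sigma>_def)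
  have strat: "projection_filter M F U k\<^sub>\<phi> k\<^sub>u von_mises_domain von_mises \<theta> \<longleftrightarrow>
      sde_solution stratonovich_integral M F U von_mises_domain b \<sigma> \<theta>" for \<theta>
    unfolding projection_filter_def
    by (intro sde_solution_cong stratonovich_integral_cong) (simp_all add: A B)
  have "sde_solution stratonovich_integral M F U von_mises_domain b \<sigma> \<theta> \<longleftrightarrow>
      sde_solution ito_integral M F U von_mises_domain b \<sigma> \<theta>" for \<theta>
    by (intro sde_solution_cong) (simp_all add: \<sigma>_def stratonovich_integral_const_eq_ito_integral)
  with A B strat show ?thesis
    by blast
qed

end
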